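(* Let $d,l\ge 1$, $n=d+l$, and let $Q=(q_1,\ldots,q_l):\mathbb{R}^d\to\mathbb{R}^l$ with $q_k(\xi)=\frac12\langle \xi,A_k\xi\rangle+\langle b_k,\xi\rangle+c_k$, where $A_k\in\mathbb{R}^{d\times d}$ is symmetric, $b_k\in\mathbb{R}^d$, $c_k\in\mathbb{R}$. Assume there is $c>0$ such that for every $\nu\in\mathbb{S}^{d-1}$ there are indices $i_1,\ldots,i_d\in\{1,\ldots,l\}$ with $|\det(A_{i_1}\nu,\ldots,A_{i_d}\nu)|\ge c$. Let $M_Q=\{(\xi,Q(\xi)):\xi\in B_d(0,1)\}\subseteq\mathbb{R}^n$. Then there is a constant $C$, independent of $\delta$ and $f$, such that for all $\delta\in(0,1)$ and all $f\in\mathcal{S}(\mathbb{R}^{n})$ with $\operatorname{supp}(\hat f)\subseteq\mathcal{N}_\delta(M_Q)$, $$\|f\|_{L^4(\mathbb{R}^n)}\le C\,\Big\|\Big(\sum_{\theta\in\Theta_\delta}|f_\theta|^2\Big)^{1/2}\Big\|_{L^4(\mathbb{R}^n)}.$$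
   Context: $B_d(0,1)$ is the open Euclidean unit ball in $\mathbb{R}^d$; $\mathcal{N}_\delta(M)=\{x:\operatorname{dist}(x,M)<\delta\}$. Canonical covering $\Theta_\delta$ of $\mathcal{N}_\delta(M_Q)$: write $\delta=r^{-2}$ and $\Gamma_Q(\eta)=(\eta,Q(\eta))$. Tangent vectors: $\mathbf{t}_i(\eta)=\partial_i\Gamma_Q(\eta)=(e_i,\partial_iq_1(\eta),\ldots,\partial_iq_l(\eta))$, $i=1,\ldots,d$. Normal vectors: $\mathbf{n}_j(\eta)=(-\partial_1q_j(\eta),\ldots,-\partial_dq_j(\eta),e_j)$, $j=1,\ldots,l$, where $e_i$, $e_j$ are standard unit vectors of $\mathbb{R}^d$, $\mathbb{R}^l$. For $\eta\in B_d(0,1)\cap r^{-1}\mathbb{Z}^d$ let $$\theta(\eta)=\Big\{\Gamma_Q(\eta)+\sum_{i=1}^d a_i\mathbf{t}_i(\eta)+\sum_{j=1}^l b_j\mathbf{n}_j(\eta):\ |a_i|\le Dr^{-1},\ |b_j|\le Dr^{-2}\Big\},$$ where $D\ge1$ is a fixed, sufficiently large constant (depending only on $d,l,Q$) so that the boxes cover $\mathcal{N}_\delta(M_Q)$. $\Theta_\delta$ is the collection of these boxes. The functions $f_\theta$ are smooth Fourier projections: $\hat f_\theta=\chi_\theta\hat f$, where $(\chi_\theta)_{\theta\in\Theta_\delta}\subseteq C_c^\infty(\mathbb{R}^n)$, $\operatorname{supp}\chi_\theta\subseteq\theta$, $0\le\chi_\theta\le1$, is a smooth partition of unity with $\sum_\theta\chi_\theta=1$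 on $\mathcal{N}_\delta(M_Q)$; hence $f=\sum_\theta f_\theta$. *)

theory Defs
  imports "HOL-Analysis.Analysis"
begin

text \<open>
  The ambient space \<open>\<real>\<^sup>n\<close>, \<open>n = d + l\<close>, is rendered as the Euclidean space
  \<open>(real^'d) \<times> (real^'l)\<close> with \<open>d = CARD('d)\<close> and \<open>l = CARD('l)\<close>; its norm, inner
  product and Lebesgue measure are the Euclidean ones of \<open>\<real>\<^sup>n\<close>.
\<close>

subsection \<open>Smooth and Schwartz functions\<close>

definition dir_deriv ::
  "'a::euclidean_space \<Rightarrow> ('a \<Rightarrow> 'b::real_normed_vector) \<Rightarrow> 'a \<Rightarrow> 'b" where
  "dir_deriv v f x = frechet_derivative f (at x) v"

fun iter_deriv ::
  "'a::euclidean_space list \<Rightarrow> ('a \<Rightarrow> 'b::real_normed_vector) \<Rightarrow> 'a \<Rightarrow> 'b" where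
  "iter_deriv [] f = f"
| "iter_deriv (v # vs) f = dir_deriv v (iter_deriv vs f)"

text \<open>
  \<open>C\<^sup>\<infinity>\<close> on the whole space: all iterated partial derivatives (\<open>vs\<close> lists the coordinate
  directions, with repetitions) exist and are differentiable. As \<open>frechet_derivative\<close> is
  unspecified where the derivative does not exist, it matters that differentiability is
  required at every order, including order 0.
\<close>

definition smooth :: "('a::euclidean_space \<Rightarrow> 'b::real_normed_vector) \<Rightarrow> bool" where
  "smooth f \<longleftrightarrow> (\<forall>vs\<in>lists Basis. \<forall>x. iter_deriv vs f differentiable (at x))"

definition schwartz :: "('a::euclidean_space \<Rightarrow> complex) \<Rightarrow> bool" where
  "schwartz f \<longleftrightarrow> smooth f \<and>
    (\<forall>vs\<in>lists Basis. \<forall>N::nat. \<exists>B. \<forall>x. norm x ^ N * norm (iter_deriv vs f x) \<le> B)"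

definition supp :: "('a::topological_space \<Rightarrow> 'b::zero) \<Rightarrow> 'a set" where
  "supp f = closure {x. f x \<noteq> 0}"

subsection \<open>Fourier transform and Lebesgue norms\<close>

definition fourier :: "('a::euclidean_space \<Rightarrow> complex) \<Rightarrow> 'a \<Rightarrow> complex" where
  "fourier f \<xi> = (LINT x|lborel. cis (- (2 * pi * (x \<bullet> \<xi>))) * f x)"

definition inv_fourier :: "('a::euclidean_space \<Rightarrow> complex) \<Rightarrow> 'a \<Rightarrow> complex" where
  "inv_fourier g x = (LINT \<xi>|lborel. cis (2 * pi * (x \<bullet> \<xi>)) * g \<xi>)"

definition fourier_proj ::
  "('a::euclidean_space \<Rightarrow> real) \<Rightarrow> ('a \<Rightarrow> complex) \<Rightarrow> 'a \<Rightarrow> complex" where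
  "fourier_proj m f = inv_fourier (\<lambda>\<xi>. complex_of_real (m \<xi>) * fourier f \<xi>)"

text \<open>
  The Bochner integral is 0 for a non-integrable integrand, so this is the \<open>L\<^sup>p\<close> norm only
  of functions in \<open>L\<^sup>p\<close>. Schwartz functions, and square functions of finitely many
  Schwartz functions, are of this kind.
\<close>

definition Lp_norm ::
  "real \<Rightarrow> ('a::euclidean_space \<Rightarrow> 'b::real_normed_vector) \<Rightarrow> real" where
  "Lp_norm p f = (LINT x|lborel. norm (f x) powr p) powr (1 / p)"

subsection \<open>The quadratic surface and its canonical covering\<close>

definition quad_map ::
  "('l::finite \<Rightarrow> real^'d^'d) \<Rightarrow> ('l \<Rightarrow> real^'d) \<Rightarrow> ('l \<Rightarrow> real) \<Rightarrow> real^'d \<Rightarrow> real^'l" where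
  "quad_map A b c \<xi> = (\<chi> k. 1/2 * (\<xi> \<bullet> (A k *v \<xi>)) + b k \<bullet> \<xi> + c k)"

definition graph_map :: "(real^'d \<Rightarrow> real^'l) \<Rightarrow> real^'d \<Rightarrow> (real^'d) \<times> (real^'l)" where
  "graph_map Q \<eta> = (\<eta>, Q \<eta>)"

definition graph_surface :: "(real^'d \<Rightarrow> real^'l) \<Rightarrow> ((real^'d) \<times> (real^'l)) set" where
  "graph_surface Q = graph_map Q ` ball 0 1"

definition nbhd :: "real \<Rightarrow> 'a::metric_space set \<Rightarrow> 'a set" where
  "nbhd \<delta> M = {x. infdist x M < \<delta>}"

definition tangent_vec ::
  "(real^'d \<Rightarrow> real^'l) \<Rightarrow> real^'d \<Rightarrow> 'd \<Rightarrow> (real^'d) \<times> (real^'l)" where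
  "tangent_vec Q \<eta> i = dir_deriv (axis i 1) (graph_map Q) \<eta>"

definition normal_vec ::
  "(real^'d \<Rightarrow> real^'l) \<Rightarrow> real^'d \<Rightarrow> 'l \<Rightarrow> (real^'d) \<times> (real^'l)" where
  "normal_vec Q \<eta> j = ((\<chi> i. - dir_deriv (axis i 1) (\<lambda>\<xi>. Q \<xi> $ j) \<eta>), axis j 1)"

definition canonical_box ::
  "real \<Rightarrow> (real^'d \<Rightarrow> real^'l) \<Rightarrow> real \<Rightarrow> real^'d \<Rightarrow> ((real^'d) \<times> (real^'l)) set" where
  "canonical_box D Q r \<eta> =
    {graph_map Q \<eta> + (\<Sum>i\<in>UNIV. a i *\<^sub>R tangent_vec Q \<eta> i)
                    + (\<Sum>j\<in>UNIV. b j *\<^sub>R normal_vec Q \<eta> j) | a b.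
      (\<forall>i. \<bar>a i\<bar> \<le> D / r) \<and> (\<forall>j. \<bar>b j\<bar> \<le> D / r\<^sup>2)}"

definition scaled_lattice :: "real \<Rightarrow> (real^'d) set" where
  "scaled_lattice r = {(1 / r) *\<^sub>R z | z. \<forall>i. z $ i \<in> \<int>}"

text \<open>The scale is \<open>r = 1 / sqrt \<delta>\<close>, that is, \<open>\<delta> = r\<^sup>-\<^sup>2\<close>.\<close>

definition canonical_cover ::
  "real \<Rightarrow> (real^'d \<Rightarrow> real^'l) \<Rightarrow> real \<Rightarrow> ((real^'d) \<times> (real^'l)) set set" where
  "canonical_cover D Q \<delta> =
    canonical_box D Q (1 / sqrt \<delta>) ` (ball 0 1 \<inter> scaled_lattice (1 / sqrt \<delta>))"

text \<open>Finiteness makes the sums over the covering genuine sums.\<close>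

lemma finite_canonical_cover:
  fixes Q :: "real^'d \<Rightarrow> real^'l"
  assumes "\<delta> > 0"
  shows "finite (canonical_cover D Q \<delta>)"
proof -
  define r where "r = 1 / sqrt \<delta>"
  have r: "r > 0" using assms by (simp add: r_def)
  define S where "S = {k::int. \<bar>real_of_int k\<bar> \<le> r}"
  have "S \<subseteq> {-\<lceil>r\<rceil>..\<lceil>r\<rceil>}"
    unfolding S_def by (auto simp: abs_le_iff) linarith+
  then have finS: "finite S" by (rule finite_subset) simp
  have "ball 0 1 \<inter> scaled_lattice r \<subseteq>
      (\<lambda>g::'d \<Rightarrow> int. (1 / r) *\<^sub>R (\<chi> i. real_of_int (g i))) ` (Pi\<^sub>E UNIV (\<lambda>_. S))"
  proof
    fix \<eta> :: "real^'d"
    assume "\<eta> \<in> ball 0 1 \<inter> scaled_lattice r"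
    then obtain z where z: "\<eta> = (1 / r) *\<^sub>R z" "\<And>i. z $ i \<in> \<int>" and n: "norm \<eta> < 1"
      unfolding scaled_lattice_def Int_iff mem_ball_0 mem_Collect_eq by blast
    define g where "g = (\<lambda>i. \<lfloor>z $ i\<rfloor>)"
    have g: "real_of_int (g i) = z $ i" for i
      using z(2)[of i] by (auto simp: g_def elim: Ints_cases)
    have "\<bar>z $ i\<bar> \<le> r" for i
    proof -
      have "\<bar>\<eta> $ i\<bar> < 1" using component_le_norm_cart[of \<eta> i] n by linarith
      then show ?thesis using r by (simp add: z(1) abs_mult field_simps)
    qed
    then have "g \<in> Pi\<^sub>E UNIV (\<lambda>_. S)" by (auto simp: S_def g)
    moreover have "(\<chi> i. real_of_int (g i)) = z" by (simp add: g vec_eq_iff)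
    ultimately show "\<eta> \<in> (\<lambda>g::'d \<Rightarrow> int. (1 / r) *\<^sub>R (\<chi> i. real_of_int (g i))) ` (Pi\<^sub>E UNIV (\<lambda>_. S))"
      using z(1) by (intro image_eqI[where x = g]) auto
  qed
  moreover have "finite (Pi\<^sub>E (UNIV::'d set) (\<lambda>_. S))" using finS by (intro finite_PiE) auto
  ultimately show ?thesis
    unfolding canonical_cover_def r_def[symmetric]
    by (intro finite_imageI) (metis finite_imageI finite_subset)
qed

definition smooth_partition ::
  "('a::euclidean_space set \<Rightarrow> 'a \<Rightarrow> real) \<Rightarrow> 'a set set \<Rightarrow> 'a set \<Rightarrow> bool" where
  "smooth_partition \<psi> \<Theta> N \<longleftrightarrow>
    (\<forall>\<theta>\<in>\<Theta>. smooth (\<psi> \<theta>) \<and> compact (supp (\<psi> \<theta>)) \<and> supp (\<psi> \<theta>) \<subseteq> \<theta> \<and>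
      (\<forall>x. 0 \<le> \<psi> \<theta> x \<and> \<psi> \<theta> x \<le> 1)) \<and>
    (\<forall>x\<in>N. (\<Sum>\<theta>\<in>\<Theta>. \<psi> \<theta> x) = 1)"

definition square_function ::
  "('a::euclidean_space set \<Rightarrow> 'a \<Rightarrow> real) \<Rightarrow> 'a set set \<Rightarrow> ('a \<Rightarrow> complex) \<Rightarrow> 'a \<Rightarrow> real" where
  "square_function \<psi> \<Theta> f x = sqrt (\<Sum>\<theta>\<in>\<Theta>. (cmod (fourier_proj (\<psi> \<theta>) f x))\<^sup>2)"

end

theory Submission
  imports Defs "HOL-Probability.Probability"
begin

text \<open>
  Expanding \<open>\<bar>f\<bar>\<^sup>4\<close> over the boxes, the integral of
  \<open>f\<^sub>1 f\<^sub>2 cnj f\<^sub>3 cnj f\<^sub>4\<close> vanishes unless \<open>p\<^sub>1 + p\<^sub>2 = p\<^sub>3 + p\<^sub>4\<close> for some points of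
  the four boxes. With \<open>\<xi>\<^sub>i\<close> the first component of \<open>p\<^sub>i\<close>, the parallelogram identity for the
  quadratic forms turns this into \<open>\<langle>\<xi>\<^sub>1 - \<xi>\<^sub>3, A\<^sub>k (\<xi>\<^sub>1 - \<xi>\<^sub>4)\<rangle> = O(r\<^sup>-\<^sup>2)\<close> for all \<open>k\<close>. By
  nondegeneracy and compactness \<open>\<bar>\<xi>\<^sub>1 - \<xi>\<^sub>3\<bar> \<bar>\<xi>\<^sub>1 - \<xi>\<^sub>4\<bar> = O(r\<^sup>-\<^sup>2)\<close>, so the pairs of boxes agree up
  to boundedly many neighbours, and Cauchy--Schwarz concludes. The Fourier inversion and
  orthogonality needed for this come from multiplying by a Gaussian \<open>exp (- \<epsilon>\<^sup>2 \<bar>x\<bar>\<^sup>2 / 2)\<close>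
  and letting \<open>\<epsilon>\<close> tend to 0.
\<close>

subsection \<open>Gaussian regularisation\<close>

text \<open>No smoothness or decay of \<open>fourier f\<close> is established: the pieces
  \<open>\<psi> \<theta> \<xi> * fourier f \<xi>\<close> enter only as measurable, bounded functions
  supported in compact sets. Their inverse transforms are then bounded, but integrability of quartic
  products must be earned, and Fubini becomes legitimate only under a Gaussian weight. Products of
  transforms are kept as superpositions over a product parameter space, which avoids convolutions:
  four factors give one superposition with frequency p1 + p2 - p3 - p4.

  Since Q is quadratic, its second differences have no remainder, so the only error in the frequency
  relation is the box thickness, of order 1/r^2. The determinant condition says that for each unit
  vector w the vectors \<open>A k *v w\<close> span the whole space; hence no nonzero v is
  orthogonal to all of them. A product of two lengths of order 1/r^2 has a factor of order 1/r,
  which is exactly the lattice spacing.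

  The constant is (2 N^2)^(1/4): 2 for the two ways to pair four indices, N for the lattice points
  at distance O(1/r) from a given one.\<close>

lemma
  fixes f :: "'a::euclidean_space \<Rightarrow> real \<Rightarrow> complex"
  assumes f: "\<And>b. b \<in> Basis \<Longrightarrow> integrable lborel (f b)"
  shows integrable_lborel_prod: "integrable lborel (\<lambda>x::'a. \<Prod>b\<in>Basis. f b (x \<bullet> b))"
    and integral_lborel_prod:
      "(LINT x|lborel. (\<Prod>b\<in>Basis. f b (x \<bullet> b))) = (\<Prod>b\<in>Basis. LINT t|lborel. f b t)"
proof -
  interpret product_sigma_finite "\<lambda>_::'a. lborel :: real measure" ..
  have [measurable]: "(\<lambda>x::'a. \<Prod>b\<in>Basis. f b (x \<bullet> b)) \<in> borel_measurable borel"
    using borel_measurable_integrable[OF f] by measurable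
  have [measurable]: "(\<lambda>g. \<Sum>b\<in>Basis. g b *\<^sub>R b) \<in> (\<Pi>\<^sub>M b\<in>(Basis::'a set). lborel) \<rightarrow>\<^sub>M borel"
    by measurable
  have eq: "(\<Prod>b\<in>Basis. f b ((\<Sum>b\<in>Basis. g b *\<^sub>R b) \<bullet> b)) = (\<Prod>b\<in>Basis. f b (g b))" for g :: "'a \<Rightarrow> real"
    by (intro prod.cong refl) simp
  \<comment> \<open>By \<open>lborel_eq\<close>, \<open>lborel\<close> is the image of this product
    measure under the coordinate map, so both claims reduce to Fubini on the product.\<close>
  have "integrable (\<Pi>\<^sub>M b\<in>(Basis::'a set). lborel) (\<lambda>g. \<Prod>b\<in>Basis. f b (g b))"
    by (intro product_integrable_prod f) auto
  then show "integrable lborel (\<lambda>x::'a. \<Prod>b\<in>Basis. f b (x \<bullet> b))"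
    unfolding lborel_eq[where 'a='a] by (subst integrable_distr_eq) (simp_all add: eq)
  have "(LINT x|lborel. (\<Prod>b\<in>Basis. f b ((x::'a) \<bullet> b))) =
      (LINT g|(\<Pi>\<^sub>M b\<in>(Basis::'a set). lborel). (\<Prod>b\<in>Basis. f b (g b)))"
    unfolding lborel_eq[where 'a='a] by (subst integral_distr) (simp_all add: eq)
  also have "\<dots> = (\<Prod>b\<in>Basis. LINT t|lborel. f b t)"
    by (intro product_integral_prod f) auto
  finally show "(LINT x|lborel. (\<Prod>b\<in>Basis. f b ((x::'a) \<bullet> b))) = (\<Prod>b\<in>Basis. LINT t|lborel. f b t)" .
qed

text \<open>This is the characteristic function of the standard normal distribution at s /
  \<epsilon>, after the substitution x = \<epsilon> t and removal of the normalising factor 1 / sqrt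
  (2 pi).\<close>

lemma has_bochner_integral_gauss_cis:
  assumes e: "\<epsilon> > 0"
  shows "has_bochner_integral lborel (\<lambda>t. cis (t * s) * complex_of_real (exp (- (\<epsilon> * t)\<^sup>2 / 2)))
    (complex_of_real (sqrt (2 * pi) / \<epsilon> * exp (- s\<^sup>2 / (2 * \<epsilon>\<^sup>2))))"
proof -
  let ?F = "\<lambda>x. cis (s / \<epsilon> * x) * complex_of_real (std_normal_density x)"
  have int: "integrable lborel ?F"
  proof (rule Bochner_Integration.integrable_bound)
    show "integrable lborel std_normal_density" by (simp add: integrable_normal_density)
    show "?F \<in> borel_measurable lborel" by (simp add: cis_conv_exp)
  qed (auto simp: norm_mult)
  have "char std_normal_distribution (s / \<epsilon>) = (LINT x|lborel. ?F x)"
    unfolding char_def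
    by (subst integral_density)
      (auto simp: cis_conv_exp scaleR_conv_of_real mult.commute normal_density_nonneg)
  then have "has_bochner_integral lborel ?F (complex_of_real (exp (- ((s / \<epsilon>)\<^sup>2) / 2)))"
    using int by (simp add: has_bochner_integral_iff char_std_normal_distribution)
  then have "has_bochner_integral lborel (\<lambda>x. ?F (0 + \<epsilon> * x))
      (complex_of_real (exp (- ((s / \<epsilon>)\<^sup>2) / 2)) /\<^sub>R \<bar>\<epsilon>\<bar>)"
    using e by (subst (asm) lborel_has_bochner_integral_real_affine_iff[where t=0 and c=\<epsilon>]) auto
  then have "has_bochner_integral lborel (\<lambda>x. complex_of_real (sqrt (2 * pi)) * ?F (0 + \<epsilon> * x))
      (complex_of_real (sqrt (2 * pi)) * (complex_of_real (exp (- ((s / \<epsilon>)\<^sup>2) / 2)) /\<^sub>R \<bar>\<epsilon>\<bar>))"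
    by (rule has_bochner_integral_mult_right)
  then show ?thesis
    using e by (simp add: std_normal_density_def field_simps scaleR_conv_of_real del: real_sqrt_mult)
qed

definition gauss :: "real \<Rightarrow> 'a::euclidean_space \<Rightarrow> real" where
  "gauss \<epsilon> x = exp (- (\<epsilon> * norm x)\<^sup>2 / 2)"

text \<open>The transform of \<open>gauss \<epsilon>\<close> for the phase
  \<open>x \<bullet> \<zeta>\<close> without the factor 2 pi. The convention of
  \<open>fourier\<close> therefore appears later as the argument
  \<open>(2 * pi) *\<^sub>R \<zeta>\<close>.\<close>

definition gauss_ft :: "real \<Rightarrow> 'a::euclidean_space \<Rightarrow> real" where
  "gauss_ft \<epsilon> \<zeta> = (sqrt (2 * pi) / \<epsilon>) ^ DIM('a) * exp (- (norm \<zeta>)\<^sup>2 / (2 * \<epsilon>\<^sup>2))"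

lemma gauss_pos: "gauss \<epsilon> x > 0" and gauss_le_1: "gauss \<epsilon> x \<le> 1"
  by (auto simp: gauss_def)

lemma gauss_measurable [measurable]: "gauss \<epsilon> \<in> borel_measurable borel"
  unfolding gauss_def by measurable

lemma gauss_ft_measurable [measurable]: "gauss_ft \<epsilon> \<in> borel_measurable borel"
  unfolding gauss_ft_def by measurable

lemma norm_sq_sum_Basis: "(norm x)\<^sup>2 = (\<Sum>b\<in>Basis. (x \<bullet> b)\<^sup>2)"
  unfolding power2_norm_eq_inner by (subst euclidean_inner) (simp add: power2_eq_square)

lemma cis_sum: "finite S \<Longrightarrow> cis (\<Sum>b\<in>S. g b) = (\<Prod>b\<in>S. cis (g b))"
  by (induction S rule: finite_induct) (auto simp: cis_mult[symmetric])

text \<open>Both the character and the Gaussian factor over the coordinates, so the one-dimensional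
  formula multiplies up.\<close>

lemma
  assumes e: "\<epsilon> > 0"
  shows integrable_gauss_cis: "integrable lborel (\<lambda>x::'a::euclidean_space. cis (x \<bullet> \<zeta>) * complex_of_real (gauss \<epsilon> x))"
    and integral_gauss_cis:
      "(LINT x|lborel. cis (x \<bullet> \<zeta>) * complex_of_real (gauss \<epsilon> x)) = complex_of_real (gauss_ft \<epsilon> (\<zeta>::'a))"
proof -
  let ?f = "\<lambda>(b::'a) t. cis (t * (\<zeta> \<bullet> b)) * complex_of_real (exp (- (\<epsilon> * t)\<^sup>2 / 2))"
  have eq: "cis (x \<bullet> \<zeta>) * complex_of_real (gauss \<epsilon> x) = (\<Prod>b\<in>Basis. ?f b (x \<bullet> b))" for x :: 'a
  proof -
    have "cis (x \<bullet> \<zeta>) = (\<Prod>b\<in>Basis. cis ((x \<bullet> b) * (\<zeta> \<bullet> b)))"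
      by (subst euclidean_inner) (simp add: cis_sum)
    moreover have "gauss \<epsilon> x = (\<Prod>b\<in>Basis. exp (- (\<epsilon> * (x \<bullet> b))\<^sup>2 / 2))"
      unfolding gauss_def power_mult_distrib norm_sq_sum_Basis
      by (simp add: exp_sum[symmetric] sum_distrib_left sum_negf sum_divide_distrib)
    ultimately show ?thesis by (simp add: prod.distrib)
  qed
  have int: "integrable lborel (?f b)" for b
    using has_bochner_integral_gauss_cis[OF e] by (auto simp: has_bochner_integral_iff)
  show "integrable lborel (\<lambda>x::'a. cis (x \<bullet> \<zeta>) * complex_of_real (gauss \<epsilon> x))"
    unfolding eq by (intro integrable_lborel_prod int)
  have "(LINT x|lborel. cis ((x::'a) \<bullet> \<zeta>) * complex_of_real (gauss \<epsilon> x)) = (\<Prod>b\<in>Basis. LINT t|lborel. ?f b t)"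
    unfolding eq by (intro integral_lborel_prod int)
  also have "\<dots> = (\<Prod>b\<in>(Basis::'a set). complex_of_real (sqrt (2 * pi) / \<epsilon> * exp (- (\<zeta> \<bullet> b)\<^sup>2 / (2 * \<epsilon>\<^sup>2))))"
    by (intro prod.cong refl has_bochner_integral_integral_eq has_bochner_integral_gauss_cis e)
  also have "\<dots> = complex_of_real ((sqrt (2 * pi) / \<epsilon>) ^ DIM('a) * (\<Prod>b\<in>(Basis::'a set). exp (- (\<zeta> \<bullet> b)\<^sup>2 / (2 * \<epsilon>\<^sup>2))))"
    unfolding of_real_prod[symmetric] prod.distrib by simp
  also have "(\<Prod>b\<in>(Basis::'a set). exp (- (\<zeta> \<bullet> b)\<^sup>2 / (2 * \<epsilon>\<^sup>2))) = exp (- (norm \<zeta>)\<^sup>2 / (2 * \<epsilon>\<^sup>2))"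
    unfolding norm_sq_sum_Basis by (simp add: exp_sum[symmetric] sum_negf sum_divide_distrib)
  finally show "(LINT x|lborel. cis ((x::'a) \<bullet> \<zeta>) * complex_of_real (gauss \<epsilon> x)) = complex_of_real (gauss_ft \<epsilon> \<zeta>)"
    by (simp add: gauss_ft_def)
qed

lemma integrable_gauss: "\<epsilon> > 0 \<Longrightarrow> integrable lborel (gauss \<epsilon> :: 'a::euclidean_space \<Rightarrow> real)"
  using integrable_gauss_cis[of \<epsilon> "0::'a"] by (simp add: complex_of_real_integrable_eq)

lemma integral_gauss:
  assumes "\<epsilon> > 0"
  shows "(LINT x::'a::euclidean_space|lborel. gauss \<epsilon> x) = (sqrt (2 * pi) / \<epsilon>) ^ DIM('a)"
proof -
  have "complex_of_real (LINT x::'a|lborel. gauss \<epsilon> x) = complex_of_real (gauss_ft \<epsilon> (0::'a))"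
    using integral_gauss_cis[OF assms, of "0::'a"] by simp
  then show ?thesis by (simp add: gauss_ft_def del: of_real_power)
qed

lemma integral_lborel_affine:
  fixes f :: "'a::euclidean_space \<Rightarrow> complex"
  assumes f[measurable]: "f \<in> borel_measurable borel" and c: "c \<noteq> 0"
  shows "(LINT x|lborel. f x) = \<bar>c\<bar> ^ DIM('a) *\<^sub>R (LINT x|lborel. f (t + c *\<^sub>R x))"
  by (subst lborel_affine[OF c, of t]) (simp add: integral_density integral_distr)

text \<open>The substitution y = x + (\<epsilon> / (2 pi)) z turns an approximate identity, whose
  kernel varies with \<epsilon>, into a fixed Gaussian weight with a shrinking displacement. In this
  form dominated convergence applies as \<epsilon> tends to 0.\<close>

lemma integral_gauss_ft_mollify:
  fixes f :: "'a::euclidean_space \<Rightarrow> complex"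
  assumes [measurable]: "f \<in> borel_measurable borel" and e: "\<epsilon> > 0"
  shows "(LINT y|lborel. f y * gauss_ft \<epsilon> ((2 * pi) *\<^sub>R (x - y))) =
    (LINT z|lborel. f (x + (\<epsilon> / (2 * pi)) *\<^sub>R z) * gauss 1 z) / sqrt (2 * pi) ^ DIM('a)"
proof -
  let ?c = "\<epsilon> / (2 * pi)"
  have *: "gauss_ft \<epsilon> ((2 * pi) *\<^sub>R (x - (x + ?c *\<^sub>R z))) = (sqrt (2 * pi) / \<epsilon>) ^ DIM('a) * gauss 1 z" for z :: 'a
    using e by (simp add: gauss_ft_def gauss_def power_mult_distrib power_divide)
  have "?c * (sqrt (2 * pi) / \<epsilon>) = 1 / sqrt (2 * pi)"
    using e by (simp add: field_simps)
  then have k: "?c ^ DIM('a) * (sqrt (2 * pi) / \<epsilon>) ^ DIM('a) = 1 / sqrt (2 * pi) ^ DIM('a)"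
    by (simp only: power_mult_distrib[symmetric] power_one_over)
  have "(LINT y|lborel. f y * gauss_ft \<epsilon> ((2 * pi) *\<^sub>R (x - y))) =
     complex_of_real (?c ^ DIM('a)) * (LINT z|lborel. f (x + ?c *\<^sub>R z) * (complex_of_real ((sqrt (2 * pi) / \<epsilon>) ^ DIM('a) * gauss 1 z)))"
  proof -
    have "(LINT y|lborel. f y * gauss_ft \<epsilon> ((2 * pi) *\<^sub>R (x - y))) =
        \<bar>?c\<bar> ^ DIM('a) *\<^sub>R (LINT z|lborel. f (x + ?c *\<^sub>R z) * gauss_ft \<epsilon> ((2 * pi) *\<^sub>R (x - (x + ?c *\<^sub>R z))))"
      using e by (intro integral_lborel_affine) auto
    then show ?thesis unfolding * using e by (simp add: scaleR_conv_of_real)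
  qed
  also have "\<dots> = complex_of_real (?c ^ DIM('a) * (sqrt (2 * pi) / \<epsilon>) ^ DIM('a)) * (LINT z|lborel. f (x + ?c *\<^sub>R z) * gauss 1 z)"
  proof -
    have "(LINT z|lborel. f (x + ?c *\<^sub>R z) * complex_of_real (K * gauss 1 z)) =
        complex_of_real K * (LINT z|lborel. f (x + ?c *\<^sub>R z) * gauss 1 z)" for K
      by (subst integral_mult_right_zero[symmetric]) (simp add: mult_ac)
    then show ?thesis by (simp only: of_real_mult mult.assoc)
  qed
  finally show ?thesis unfolding k by simp
qed

lemma integral_gauss_ft:
  assumes "\<epsilon> > 0"
  shows "(LINT y|lborel. gauss_ft \<epsilon> ((2 * pi) *\<^sub>R (x - y))) = (1::real)" (is ?a)
    and "integrable lborel (\<lambda>y::'a::euclidean_space. gauss_ft \<epsilon> ((2 * pi) *\<^sub>R (x - y)))" (is ?b)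
proof -
  have "complex_of_real (LINT y|lborel. gauss_ft \<epsilon> ((2 * pi) *\<^sub>R (x - y))) = 1"
    using integral_gauss_ft_mollify[of "\<lambda>_. 1" \<epsilon> x] assms integral_gauss[of 1, where 'a='a]
    by simp
  then show ?a by (metis of_real_eq_1_iff)
  \<comment> \<open>The Bochner integral of a non-integrable function is 0, so the value 1 already
    proves integrability.\<close>
  then show ?b using not_integrable_integral_eq by fastforce
qed

subsection \<open>Superpositions of plane waves\<close>

text \<open>One object for all transforms: the frequency map is the identity for
  \<open>inv_fourier\<close>, \<open>uminus\<close> for \<open>fourier\<close>, changes sign under
  conjugation, and for a product is the sum of the two maps on the product space. The parameter
  space \<open>'b\<close> is separate from \<open>'a\<close> precisely so that products remain of
  this form.\<close>

definition waves :: "('b::euclidean_space \<Rightarrow> 'a::euclidean_space) \<Rightarrow> ('b \<Rightarrow> complex) \<Rightarrow> 'a \<Rightarrow> complex" where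
  "waves \<Phi> w x = (LINT p|lborel. cis (2 * pi * (x \<bullet> \<Phi> p)) * w p)"

lemma inv_fourier_waves: "inv_fourier h = waves (\<lambda>\<xi>. \<xi>) h"
  by (simp add: inv_fourier_def waves_def fun_eq_iff)

lemma waves_integrable:
  fixes \<Phi> :: "'b::euclidean_space \<Rightarrow> 'a::euclidean_space"
  assumes [measurable]: "\<Phi> \<in> borel_measurable borel" and w: "integrable lborel w"
  shows "integrable lborel (\<lambda>p. cis (2 * pi * (x \<bullet> \<Phi> p)) * w p)"
proof (rule Bochner_Integration.integrable_bound[OF w])
  have [measurable]: "w \<in> borel_measurable borel" using w by auto
  show "(\<lambda>p. cis (2 * pi * (x \<bullet> \<Phi> p)) * w p) \<in> borel_measurable lborel"
    unfolding cis_conv_exp by measurable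
qed (simp add: norm_mult)

lemma waves_measurable [measurable]:
  assumes [measurable]: "\<Phi> \<in> borel_measurable borel" and w: "integrable lborel w"
  shows "waves \<Phi> w \<in> borel_measurable borel"
proof -
  have [measurable]: "w \<in> borel_measurable borel" using w by auto
  show ?thesis unfolding waves_def cis_conv_exp by measurable
qed

lemma norm_waves_le: "norm (waves \<Phi> w x) \<le> (LINT p|lborel. norm (w p))"
  unfolding waves_def
  by (rule order_trans[OF integral_norm_bound]) (simp add: norm_mult)

lemma cnj_waves: "cnj (waves \<Phi> w x) = waves (\<lambda>p. - \<Phi> p) (\<lambda>p. cnj (w p)) x"
  unfolding waves_def by (subst Bochner_Integration.integral_cnj[symmetric]) (simp add: cis_cnj)

lemma integrable_tensor:
  fixes h :: "'b::euclidean_space \<Rightarrow> complex" and k :: "'c::euclidean_space \<Rightarrow> complex"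
  assumes h: "integrable lborel h" and k: "integrable lborel k"
  shows "integrable lborel (\<lambda>p. h (fst p) * k (snd p))"
proof -
  have [measurable]: "h \<in> borel_measurable borel" "k \<in> borel_measurable borel" using h k by auto
  have "integrable (lborel \<Otimes>\<^sub>M lborel) (\<lambda>p. h (fst p) * k (snd p))"
    by (rule lborel_pair.Fubini_integrable) (use h k in \<open>auto simp: norm_mult\<close>)
  then show ?thesis by (simp add: lborel_prod)
qed

lemma waves_mult:
  fixes h :: "'b::euclidean_space \<Rightarrow> complex" and k :: "'c::euclidean_space \<Rightarrow> complex"
  assumes h: "integrable lborel h" and k: "integrable lborel k"
    and [measurable]: "\<Phi> \<in> borel_measurable borel" "\<Psi> \<in> borel_measurable borel"
  shows "waves \<Phi> h x * waves \<Psi> k x =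
    waves (\<lambda>p. \<Phi> (fst p) + \<Psi> (snd p)) (\<lambda>p. h (fst p) * k (snd p)) x"
proof -
  let ?F = "\<lambda>p. cis (2 * pi * (x \<bullet> (\<Phi> (fst p) + \<Psi> (snd p)))) * (h (fst p) * k (snd p))"
  have m: "(\<lambda>p::'b\<times>'c. \<Phi> (fst p) + \<Psi> (snd p)) \<in> borel_measurable borel"
    unfolding borel_prod[symmetric] by measurable
  have "integrable lborel ?F"
    by (intro waves_integrable m integrable_tensor h k)
  then have int: "integrable (lborel \<Otimes>\<^sub>M lborel) ?F" by (simp add: lborel_prod)
  have "waves (\<lambda>p. \<Phi> (fst p) + \<Psi> (snd p)) (\<lambda>p. h (fst p) * k (snd p)) x = integral\<^sup>L (lborel \<Otimes>\<^sub>M lborel) ?F"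
    by (simp add: waves_def lborel_prod)
  also have "\<dots> = (LINT a|lborel. LINT b|lborel. ?F (a, b))"
    by (rule lborel_pair.integral_fst'[OF int, symmetric])
  also have "\<dots> = (LINT a|lborel. LINT b|lborel. (cis (2 * pi * (x \<bullet> \<Phi> a)) * h a) * (cis (2 * pi * (x \<bullet> \<Psi> b)) * k b))"
    by (simp add: inner_add_right distrib_left cis_mult[symmetric] mult_ac)
  also have "\<dots> = waves \<Phi> h x * waves \<Psi> k x"
    unfolding waves_def by simp
  finally show ?thesis ..
qed

text \<open>The Gaussian makes the double integral absolutely convergent, so Fubini holds although
  \<open>waves \<Phi> w\<close> itself may fail to be integrable. Inversion, orthogonality and
  square integrability below all rest on this identity.\<close>

lemma integral_gauss_waves:
  fixes w :: "'b::euclidean_space \<Rightarrow> complex" and \<Phi> :: "'b \<Rightarrow> 'a::euclidean_space"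
  assumes w: "integrable lborel w" and [measurable]: "\<Phi> \<in> borel_measurable borel" and e: "\<epsilon> > 0"
  shows "(LINT x|lborel. gauss \<epsilon> x * waves \<Phi> w x) = (LINT p|lborel. w p * gauss_ft \<epsilon> ((2 * pi) *\<^sub>R \<Phi> p))"
proof -
  have [measurable]: "w \<in> borel_measurable borel" using w by auto
  let ?F = "\<lambda>(x, p). gauss \<epsilon> x * (cis (2 * pi * (x \<bullet> \<Phi> p)) * w p)"
  have m: "?F \<in> borel_measurable (lborel \<Otimes>\<^sub>M lborel)"
    unfolding cis_conv_exp by measurable
  have int: "integrable (lborel \<Otimes>\<^sub>M lborel) ?F"
  proof (rule lborel_pair.Fubini_integrable[OF m])
    show "integrable lborel (\<lambda>x. LINT p|lborel. norm (?F (x, p)))"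
      using integrable_gauss[OF e] gauss_pos[of \<epsilon>] by (auto simp: norm_mult less_imp_le)
    show "AE x in lborel. integrable lborel (\<lambda>p. ?F (x, p))"
      using waves_integrable[OF assms(2) w] by (intro AE_I2) simp
  qed
  have "(LINT x|lborel. gauss \<epsilon> x * waves \<Phi> w x) = (LINT x|lborel. LINT p|lborel. ?F (x, p))"
    unfolding waves_def by simp
  also have "\<dots> = integral\<^sup>L (lborel \<Otimes>\<^sub>M lborel) ?F"
    by (rule lborel_pair.integral_fst'[OF int])
  also have "\<dots> = (LINT p|lborel. LINT x|lborel. gauss \<epsilon> x * (cis (2 * pi * (x \<bullet> \<Phi> p)) * w p))"
    using lborel_pair.integral_snd[of "\<lambda>x p. gauss \<epsilon> x * (cis (2 * pi * (x \<bullet> \<Phi> p)) * w p)"] int by simp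
  also have "\<dots> = (LINT p|lborel. w p * (LINT x|lborel. cis (x \<bullet> ((2 * pi) *\<^sub>R \<Phi> p)) * gauss \<epsilon> x))"
    using e by (intro Bochner_Integration.integral_cong refl)
      (simp add: integrable_gauss_cis mult_ac flip: integral_mult_right_zero)
  finally show ?thesis by (simp only: integral_gauss_cis[OF e])
qed

section \<open>Removing the Gaussian: inversion, orthogonality and square integrability\<close>

abbreviation eps :: "nat \<Rightarrow> real" where "eps n \<equiv> 1 / real (Suc n)"

lemma gauss_eps_tendsto: "(\<lambda>n. gauss (eps n) x) \<longlonglongrightarrow> 1"
proof -
  have "(\<lambda>n. exp (- (eps n * norm x)\<^sup>2 / 2)) \<longlonglongrightarrow> exp (- (0 * norm x)\<^sup>2 / 2)"
    by (intro tendsto_intros LIMSEQ_Suc[OF lim_1_over_n]) auto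
  then show ?thesis by (simp add: gauss_def)
qed

lemma integral_gauss_tendsto:
  fixes g :: "'a::euclidean_space \<Rightarrow> complex"
  assumes g: "integrable lborel g"
  shows "(\<lambda>n. LINT x|lborel. gauss (eps n) x * g x) \<longlonglongrightarrow> (LINT x|lborel. g x)"
proof (rule integral_dominated_convergence[where w="\<lambda>x. norm (g x)"])
  show "AE x in lborel. (\<lambda>n. gauss (eps n) x * g x) \<longlonglongrightarrow> g x"
  proof (rule AE_I2)
    fix x :: 'a
    have "(\<lambda>n. gauss (eps n) x * g x) \<longlonglongrightarrow> of_real 1 * g x"
      by (intro tendsto_mult tendsto_of_real gauss_eps_tendsto tendsto_const)
    then show "(\<lambda>n. gauss (eps n) x * g x) \<longlonglongrightarrow> g x" by simp
  qed
  show "AE x in lborel. norm (gauss (eps n) x * g x) \<le> norm (g x)" for n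
    by (intro AE_I2)
      (simp only: norm_mult norm_of_real abs_of_pos[OF gauss_pos] mult_left_le_one_le gauss_le_1 gauss_pos norm_ge_zero less_imp_le)
qed (use g in auto)

theorem fourier_inversion:
  fixes f :: "'a::euclidean_space \<Rightarrow> complex"
  assumes f: "integrable lborel f" and cont: "continuous_on UNIV f" and bound: "\<And>x. norm (f x) \<le> B"
    and fh: "integrable lborel (fourier f)"
  shows "inv_fourier (fourier f) x = f x"
proof -
  have fm[measurable]: "f \<in> borel_measurable borel" using f by auto
  \<comment> \<open>For fixed x the integrand of the inversion integral is itself a superposition in
    \<xi>, with frequencies x - y and weight f. The Gaussian-weighted inversion integral is thus f
    mollified at x, and both descriptions have a limit.\<close>
  have eq: "cis (2 * pi * (x \<bullet> \<xi>)) * fourier f \<xi> = waves (\<lambda>y. x - y) f \<xi>" for \<xi>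
    unfolding fourier_def waves_def
    by (subst integral_mult_right_zero[symmetric], intro Bochner_Integration.integral_cong refl)
      (simp add: cis_mult mult.assoc[symmetric], simp add: inner_diff_right inner_commute right_diff_distrib)
  have int: "integrable lborel (\<lambda>\<xi>. cis (2 * pi * (x \<bullet> \<xi>)) * fourier f \<xi>)"
    by (rule waves_integrable[where \<Phi>="\<lambda>x. x"]) (use fh in auto)
  let ?s = "\<lambda>n. LINT \<xi>|lborel. gauss (eps n) \<xi> * (cis (2 * pi * (x \<bullet> \<xi>)) * fourier f \<xi>)"
  have lim1: "?s \<longlonglongrightarrow> inv_fourier (fourier f) x"
    unfolding inv_fourier_def by (rule integral_gauss_tendsto[OF int])
  have s: "?s n = (LINT z|lborel. f (x + (eps n / (2 * pi)) *\<^sub>R z) * gauss 1 z) / sqrt (2 * pi) ^ DIM('a)" for n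
  proof -
    have "?s n = (LINT y|lborel. f y * gauss_ft (eps n) ((2 * pi) *\<^sub>R (x - y)))"
      unfolding eq by (rule integral_gauss_waves[OF f]) auto
    then show ?thesis by (simp only: integral_gauss_ft_mollify[OF fm] of_nat_0_less_iff zero_less_Suc zero_less_divide_1_iff)
  qed
  have lim2: "(\<lambda>n. LINT z|lborel. f (x + (eps n / (2 * pi)) *\<^sub>R z) * gauss 1 z) \<longlonglongrightarrow> (LINT z|lborel. f x * gauss 1 (z::'a))"
  proof (rule integral_dominated_convergence[where w="\<lambda>z. B * gauss 1 z"])
    show "AE z in lborel. (\<lambda>n. f (x + (eps n / (2 * pi)) *\<^sub>R z) * gauss 1 z) \<longlonglongrightarrow> f x * gauss 1 z"
    proof (rule AE_I2)
      fix z :: 'a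
      have "(\<lambda>n. x + (eps n / (2 * pi)) *\<^sub>R z) \<longlonglongrightarrow> x + (0 / (2 * pi)) *\<^sub>R z"
        by (intro tendsto_intros LIMSEQ_Suc[OF lim_1_over_n]) auto
      moreover have "isCont f x" using cont by (simp add: continuous_on_eq_continuous_at)
      ultimately have "(\<lambda>n. f (x + (eps n / (2 * pi)) *\<^sub>R z)) \<longlonglongrightarrow> f x"
        using isCont_tendsto_compose by fastforce
      then show "(\<lambda>n. f (x + (eps n / (2 * pi)) *\<^sub>R z) * gauss 1 z) \<longlonglongrightarrow> f x * gauss 1 z"
        by (intro tendsto_mult tendsto_const)
    qed
    show "AE z in lborel. norm (f (x + (eps n / (2 * pi)) *\<^sub>R z) * gauss 1 z) \<le> B * gauss 1 z" for n
      using gauss_pos[where 'a='a] bound by (intro AE_I2) (auto simp: norm_mult less_imp_le intro!: mult_right_mono)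
  qed (auto intro: integrable_gauss)
  let ?K = "complex_of_real (sqrt (2 * pi) ^ DIM('a))"
  have K: "?K \<noteq> 0" by simp
  have "?s \<longlonglongrightarrow> (LINT z|lborel. f x * gauss 1 (z::'a)) / ?K"
    unfolding s by (rule tendsto_divide[OF lim2 tendsto_const K])
  with lim1 have "inv_fourier (fourier f) x = (LINT z|lborel. f x * gauss 1 (z::'a)) / ?K"
    by (rule LIMSEQ_unique)
  also have "(LINT z|lborel. f x * gauss 1 (z::'a)) = f x * complex_of_real (LINT z|lborel. gauss 1 (z::'a))"
    by (simp add: integral_complex_of_real)
  also have "\<dots> = f x * ?K"
    by (simp add: integral_gauss)
  finally show ?thesis using K by simp
qed

text \<open>The integral of a superposition sees only frequency 0. With the Gaussian inserted, it
  becomes the integral of \<open>w\<close> against \<open>gauss_ft\<close>, which at frequencies of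
  norm at least s is bounded by \<open>?g n\<close>. The exponential there beats the power of n,
  while integrability of the wave identifies the limit with the integral itself.\<close>

lemma integral_waves_eq_0:
  fixes w :: "'b::euclidean_space \<Rightarrow> complex" and \<Phi> :: "'b \<Rightarrow> 'a::euclidean_space"
  assumes w: "integrable lborel w" and [measurable]: "\<Phi> \<in> borel_measurable borel"
    and int: "integrable lborel (waves \<Phi> w)"
    and s: "s > 0" and far: "\<And>p. w p \<noteq> 0 \<Longrightarrow> norm (\<Phi> p) \<ge> s"
  shows "(LINT x|lborel. waves \<Phi> w x) = 0"
proof -
  let ?g = "\<lambda>n. (sqrt (2 * pi) * real (Suc n)) ^ DIM('a) * exp (- (2 * pi * s)\<^sup>2 / 2 * (real (Suc n))\<^sup>2)"
  have bnd: "norm (LINT x|lborel. gauss (eps n) x * waves \<Phi> w x) \<le> ?g n * (LINT p|lborel. norm (w p))" for n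
  proof -
    have "norm (LINT x|lborel. gauss (eps n) x * waves \<Phi> w x) =
        norm (LINT p|lborel. w p * gauss_ft (eps n) ((2 * pi) *\<^sub>R \<Phi> p))"
      using integral_gauss_waves[OF w, of \<Phi> "eps n"] by simp
    also have "\<dots> \<le> (LINT p|lborel. ?g n * norm (w p))"
    proof (rule Bochner_Integration.integral_norm_bound_integral)
      have le: "norm (w p * gauss_ft (eps n) ((2 * pi) *\<^sub>R \<Phi> p)) \<le> ?g n * norm (w p)" for p
      proof (cases "w p = 0")
        case False
        have "gauss_ft (eps n) ((2 * pi) *\<^sub>R \<Phi> p) =
          (sqrt (2 * pi) * real (Suc n)) ^ DIM('a) * exp (- (2 * pi * norm (\<Phi> p))\<^sup>2 / 2 * (real (Suc n))\<^sup>2)"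
          by (simp add: gauss_ft_def field_simps power_divide)
        also have "\<dots> \<le> ?g n"
          using far[OF False] s by (intro mult_left_mono) (auto intro!: mult_right_mono power_mono mult_left_mono)
        finally have "gauss_ft (eps n) ((2 * pi) *\<^sub>R \<Phi> p) \<le> ?g n" .
        moreover have "gauss_ft (eps n) ((2 * pi) *\<^sub>R \<Phi> p) \<ge> 0" by (simp add: gauss_ft_def)
        ultimately show ?thesis
          by (simp only: norm_mult norm_of_real abs_of_nonneg mult.commute[of "norm (w p)"] mult_right_mono norm_ge_zero)
      qed simp
      show "integrable lborel (\<lambda>p. ?g n * norm (w p))" using w by auto
      then show "integrable lborel (\<lambda>p. w p * gauss_ft (eps n) ((2 * pi) *\<^sub>R \<Phi> p))"
        by (rule Bochner_Integration.integrable_bound)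
          (use borel_measurable_integrable[OF w] le in \<open>auto intro: order_trans[OF le]\<close>)
      show "norm (w p * gauss_ft (eps n) ((2 * pi) *\<^sub>R \<Phi> p)) \<le> ?g n * norm (w p)" for p by (rule le)
    qed
    finally show ?thesis by simp
  qed
  have "?g \<longlonglongrightarrow> 0"
  proof -
    define a where "a = (2 * pi * s)\<^sup>2 / 2"
    have a: "a > 0" using s by (simp add: a_def)
    \<comment> \<open>For x \<ge> 1 one has exp (- a x^2) \<le> exp (- a x), which reduces the decay
      to that of a power divided by an exponential.\<close>
    have "((\<lambda>x::real. (sqrt (2 * pi) * x) ^ DIM('a) * exp (- a * x\<^sup>2)) \<longlongrightarrow> 0) at_top"
    proof (rule tendsto_sandwich[where f="\<lambda>_. 0" and h="\<lambda>x. (sqrt (2*pi) / a) ^ DIM('a) * ((a * x) ^ DIM('a) / exp (a * x))"])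
      show "\<forall>\<^sub>F x in at_top. 0 \<le> (sqrt (2 * pi) * x) ^ DIM('a) * exp (- a * x\<^sup>2)"
        using eventually_ge_at_top[of 0] by eventually_elim auto
      show "\<forall>\<^sub>F x in at_top. (sqrt (2 * pi) * x) ^ DIM('a) * exp (- a * x\<^sup>2) \<le> (sqrt (2*pi) / a) ^ DIM('a) * ((a * x) ^ DIM('a) / exp (a * x))"
        using eventually_ge_at_top[of "1::real"]
      proof eventually_elim
        case (elim x)
        have "a * x \<le> a * x\<^sup>2" using a elim by (simp add: power2_eq_square)
        then have "exp (- a * x\<^sup>2) \<le> exp (- (a * x))" by simp
        moreover have "(sqrt (2*pi) / a) ^ DIM('a) * (a * x) ^ DIM('a) = (sqrt (2 * pi) * x) ^ DIM('a)"
          using a by (simp add: power_mult_distrib[symmetric])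
        ultimately show ?case using elim
          by (simp add: exp_minus divide_inverse mult.assoc[symmetric] del: mult_minus_left)
      qed
      have "((\<lambda>x. (a * x) ^ DIM('a) / exp (a * x)) \<longlongrightarrow> 0) at_top"
        using tendsto_power_div_exp_0[of "DIM('a)"] filterlim_tendsto_pos_mult_at_top[OF tendsto_const[of a] a filterlim_ident]
        by (rule filterlim_compose)
      then show "((\<lambda>x. (sqrt (2*pi) / a) ^ DIM('a) * ((a * x) ^ DIM('a) / exp (a * x))) \<longlongrightarrow> 0) at_top"
        by (rule tendsto_mult_right_zero)
    qed auto
    from filterlim_compose[OF this filterlim_compose[OF filterlim_real_sequentially filterlim_Suc]]
    show ?thesis by (simp add: a_def)
  qed
  then have "(\<lambda>n. ?g n * (LINT p|lborel. norm (w p))) \<longlonglongrightarrow> 0"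
    by (rule tendsto_mult_left_zero)
  then have "(\<lambda>n. LINT x|lborel. gauss (eps n) x * waves \<Phi> w x) \<longlonglongrightarrow> 0"
    by (rule Lim_null_comparison[rotated]) (use bnd in auto)
  with integral_gauss_tendsto[OF int] show ?thesis
    using LIMSEQ_unique by blast
qed

text \<open>The part of Plancherel that is needed: finiteness only. The Gaussian-weighted integral
  of |F|^2 equals a double integral of h(a) and the conjugate of h(b) against an approximate
  identity in a - b. Bounding one factor by B and using that the kernel has mass 1 gives a bound
  independent of n, and monotone convergence removes the weight.\<close>

lemma inv_fourier_square_integrable:
  fixes h :: "'a::euclidean_space \<Rightarrow> complex"
  assumes h: "integrable lborel h" and bound: "\<And>\<xi>. norm (h \<xi>) \<le> B"
  shows "integrable lborel (\<lambda>x. (norm (inv_fourier h x))\<^sup>2)"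
proof -
  have [measurable]: "h \<in> borel_measurable borel" using h by auto
  have ch: "integrable lborel (\<lambda>\<xi>. cnj (h \<xi>))" using h by simp
  let ?F = "inv_fourier h" let ?\<Phi> = "\<lambda>p::'a\<times>'a. fst p + - snd p" let ?w = "\<lambda>p. h (fst p) * cnj (h (snd p))"
  have [measurable]: "?F \<in> borel_measurable borel" unfolding inv_fourier_waves using h by measurable
  have \<Phi>m: "?\<Phi> \<in> borel_measurable borel"
    by (intro borel_measurable_continuous_onI continuous_intros)
  have w: "integrable lborel ?w" by (rule integrable_tensor[OF h ch])
  have sq: "complex_of_real ((norm (?F x))\<^sup>2) = waves ?\<Phi> ?w x" for x
    unfolding complex_norm_square inv_fourier_waves cnj_waves
    by (subst waves_mult) (use h in auto)
  have bd: "(LINT x|lborel. gauss (eps n) x * (norm (?F x))\<^sup>2) \<le> B * (LINT \<xi>|lborel. norm (h \<xi>))" for n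
  proof -
    let ?G = "\<lambda>p::'a\<times>'a. ?w p * gauss_ft (eps n) ((2 * pi) *\<^sub>R ?\<Phi> p)"
    have G0: "gauss_ft (eps n) x \<ge> 0" for x :: 'a by (simp add: gauss_ft_def)
    have intG: "integrable lborel ?G"
    proof -
      let ?K = "(sqrt (2 * pi) * real (Suc n)) ^ DIM('a)"
      have "gauss_ft (eps n) (x::'a) \<le> ?K" for x
        unfolding gauss_ft_def by (simp add: mult_left_le)
      then have "norm (?w p) * gauss_ft (eps n) ((2 * pi) *\<^sub>R ?\<Phi> p) \<le> norm (?w p) * ?K" for p
        by (intro mult_left_mono) auto
      moreover have "norm (?G p) = norm (?w p) * gauss_ft (eps n) ((2 * pi) *\<^sub>R ?\<Phi> p)" for p
        using G0 by (simp only: norm_mult norm_of_real abs_of_nonneg)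
      moreover have "norm (?K * ?w p) = norm (?w p) * ?K" for p
        unfolding norm_mult norm_of_real by simp
      ultimately have le: "norm (?G p) \<le> norm (?K * ?w p)" for p
        by simp
      have "integrable lborel (\<lambda>p. ?K * ?w p)" using w by auto
      then show ?thesis
      proof (rule Bochner_Integration.integrable_bound)
        have "(\<lambda>p. complex_of_real (gauss_ft (eps n) ((2 * pi) *\<^sub>R ?\<Phi> p))) \<in> borel_measurable borel"
          using \<Phi>m by measurable
        then show "?G \<in> borel_measurable lborel"
          using borel_measurable_times[OF borel_measurable_integrable[OF w]] by simp
      qed (use le in auto)
    qed
    have "(LINT x|lborel. gauss (eps n) x * (norm (?F x))\<^sup>2) \<le> norm (complex_of_real (LINT x|lborel. gauss (eps n) x * (norm (?F x))\<^sup>2))"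
      by simp
    also have "complex_of_real (LINT x|lborel. gauss (eps n) x * (norm (?F x))\<^sup>2) =
        (LINT x|lborel. gauss (eps n) x * waves ?\<Phi> ?w x)"
      unfolding integral_complex_of_real[symmetric] of_real_mult sq ..
    also have "\<dots> = (LINT p|lborel. ?G p)"
      by (rule integral_gauss_waves[OF w \<Phi>m]) simp
    also have "\<dots> = (LINT a|lborel. LINT b|lborel. ?G (a, b))"
      using lborel_pair.integral_fst'[of ?G] intG by (simp add: lborel_prod)
    also have "norm \<dots> \<le> (LINT a|lborel. B * norm (h a))"
    proof (rule Bochner_Integration.integral_norm_bound_integral)
      show "integrable lborel (\<lambda>a. LINT b|lborel. ?G (a, b))"
        by (rule lborel_pair.integrable_fst') (use intG in \<open>simp add: lborel_prod\<close>)
      show "integrable lborel (\<lambda>a. B * norm (h a))" using h by auto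
      fix a
      have "norm (LINT b|lborel. ?G (a, b)) \<le> (LINT b|lborel. norm (h a) * B * gauss_ft (eps n) ((2 * pi) *\<^sub>R (a - b)))"
      proof (rule Bochner_Integration.integral_norm_bound_integral)
        show i: "integrable lborel (\<lambda>b. norm (h a) * B * gauss_ft (eps n) ((2 * pi) *\<^sub>R (a - b)))"
          by (intro integrable_mult_right integral_gauss_ft(2)) auto
        have "norm (?G (a, b)) \<le> norm (h a) * B * gauss_ft (eps n) ((2 * pi) *\<^sub>R (a - b))" for b
          using G0 bound by (auto simp: norm_mult intro!: mult_right_mono mult_left_mono)
        then show le: "norm (?G (a, b)) \<le> norm (h a) * B * gauss_ft (eps n) ((2 * pi) *\<^sub>R (a - b))" for b .
        show "integrable lborel (\<lambda>b. ?G (a, b))"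
        proof (rule Bochner_Integration.integrable_bound[OF i])
          have "integrable lborel (\<lambda>b. complex_of_real (gauss_ft (eps n) ((2 * pi) *\<^sub>R (a + - b))))"
            using integral_gauss_ft(2)[of "eps n" a] by (intro integrable_of_real) simp
          then show "(\<lambda>b. ?G (a, b)) \<in> borel_measurable lborel"
            unfolding fst_conv snd_conv using ch
            by (intro borel_measurable_times borel_measurable_const borel_measurable_integrable)
        qed (intro AE_I2 order_trans[OF le], simp)
      qed
      also have "\<dots> = B * norm (h a)" by (simp add: integral_gauss_ft(1))
      finally show "norm (LINT b|lborel. ?G (a, b)) \<le> B * norm (h a)" .
    qed
    finally show ?thesis by simp
  qed
  have bdF: "norm (?F x) \<le> (LINT \<xi>|lborel. norm (h \<xi>))" for x
    unfolding inv_fourier_waves by (rule norm_waves_le)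
  have i1: "integrable lborel (\<lambda>x. gauss (eps n) x * (norm (?F x))\<^sup>2)" for n
  proof (rule Bochner_Integration.integrable_bound)
    show "integrable lborel (\<lambda>x::'a. (LINT \<xi>|lborel. norm (h \<xi>))\<^sup>2 * gauss (eps n) x)"
      by (intro integrable_mult_right integrable_gauss) auto
    show "AE x in lborel. norm (gauss (eps n) x * (norm (?F x))\<^sup>2) \<le> norm ((LINT \<xi>|lborel. norm (h \<xi>))\<^sup>2 * gauss (eps n) x)"
      using gauss_pos[of "eps n", where 'a='a] bdF
      by (auto simp: abs_mult less_imp_le mult.commute intro!: mult_left_mono power_mono)
  qed auto
  \<comment> \<open>A smaller \<epsilon> gives a wider Gaussian, so the weights increase with
    n.\<close>
  have mono: "gauss (eps m) x \<le> gauss (eps n) x" if "m \<le> n" for m n and x :: 'a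
    unfolding gauss_def using that
    by (auto intro!: power_mono mult_left_mono simp: divide_simps)
  let ?I = "\<lambda>n. LINT x|lborel. gauss (eps n) x * (norm (?F x))\<^sup>2"
  have "mono ?I"
    by (intro monoI integral_mono i1 mult_right_mono mono) auto
  then have "incseq ?I" .
  moreover have "Bseq ?I"
  proof (rule BseqI')
    have "0 \<le> ?I n" for n
      by (intro Bochner_Integration.integral_nonneg) (simp add: less_imp_le gauss_pos)
    then show "norm (?I n) \<le> B * (LINT \<xi>|lborel. norm (h \<xi>))" for n
      using bd[of n] by simp
  qed
  ultimately obtain L where L: "?I \<longlonglongrightarrow> L"
    using Bseq_monoseq_convergent convergent_def incseq_imp_monoseq by blast
  show ?thesis
  proof (rule integrable_monotone_convergence[OF i1 _ _ L])
    show "AE x in lborel. mono (\<lambda>n. gauss (eps n) x * (norm (?F x))\<^sup>2)"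
      by (intro AE_I2 monoI mult_right_mono mono) auto
    show "AE x in lborel. (\<lambda>n. gauss (eps n) x * (norm (?F x))\<^sup>2) \<longlonglongrightarrow> (norm (?F x))\<^sup>2"
      using tendsto_mult_right[OF gauss_eps_tendsto] by fastforce
  qed measurable
qed

subsection \<open>Fourth moments of sums with few additive quadruples\<close>

lemma inv_fourier_measurable: "integrable lborel h \<Longrightarrow> inv_fourier h \<in> borel_measurable borel"
  unfolding inv_fourier_waves by (rule waves_measurable) auto

text \<open>Two factors are bounded by the L^1 norms of their transforms, and the product of the
  other two is dominated by a sum of squares, which is integrable by the square integrability
  above.\<close>

lemma inv_fourier_quartic_integrable:
  fixes h :: "'i \<Rightarrow> 'a::euclidean_space \<Rightarrow> complex"
  assumes h: "\<And>i. i \<in> I \<Longrightarrow> integrable lborel (h i)" and bound: "\<And>i \<xi>. i \<in> I \<Longrightarrow> norm (h i \<xi>) \<le> B"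
    and I: "i \<in> I" "j \<in> I" "k \<in> I" "l \<in> I"
  shows "integrable lborel (\<lambda>x. inv_fourier (h i) x * inv_fourier (h j) x *
    (cnj (inv_fourier (h k) x) * cnj (inv_fourier (h l) x)))"
proof -
  let ?F = "\<lambda>i. inv_fourier (h i)" let ?n = "\<lambda>i. LINT \<xi>|lborel. norm (h i \<xi>)"
  have [measurable]: "?F i \<in> borel_measurable borel" "?F j \<in> borel_measurable borel"
    "?F k \<in> borel_measurable borel" "?F l \<in> borel_measurable borel"
    using I h by (auto intro: inv_fourier_measurable)
  have [measurable]: "(\<lambda>x. cnj (?F k x)) \<in> borel_measurable borel" "(\<lambda>x. cnj (?F l x)) \<in> borel_measurable borel"
    by (rule measurable_compose[OF _ borel_measurable_continuous_onI]; auto intro: continuous_intros)+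
  have le: "norm (?F m x) \<le> ?n m" for m x
    unfolding inv_fourier_waves by (rule norm_waves_le)
  show ?thesis
  proof (rule Bochner_Integration.integrable_bound)
    show "integrable lborel (\<lambda>x. ?n k * ?n l * ((norm (?F i x))\<^sup>2 + (norm (?F j x))\<^sup>2))"
      by (intro integrable_mult_right Bochner_Integration.integrable_add inv_fourier_square_integrable[OF h bound] I)
    show "AE x in lborel. norm (?F i x * ?F j x * (cnj (?F k x) * cnj (?F l x))) \<le>
        norm (?n k * ?n l * ((norm (?F i x))\<^sup>2 + (norm (?F j x))\<^sup>2))"
    proof (rule AE_I2)
      fix x
      have "norm (?F i x) * norm (?F j x) \<le> (norm (?F i x))\<^sup>2 + (norm (?F j x))\<^sup>2"
        using sum_squares_bound[of "norm (?F i x)" "norm (?F j x)"]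
          mult_nonneg_nonneg[OF norm_ge_zero norm_ge_zero, of "?F i x" "?F j x"] by linarith
      moreover have "norm (?F k x) * norm (?F l x) \<le> ?n k * ?n l"
        using le by (intro mult_mono) auto
      ultimately have "norm (?F i x * ?F j x * (cnj (?F k x) * cnj (?F l x))) \<le>
          ((norm (?F i x))\<^sup>2 + (norm (?F j x))\<^sup>2) * (?n k * ?n l)"
        unfolding norm_mult complex_mod_cnj by (rule mult_mono) auto
      also have "\<dots> \<le> norm (?n k * ?n l * ((norm (?F i x))\<^sup>2 + (norm (?F j x))\<^sup>2))"
        by (simp add: mult.commute)
      finally show "norm (?F i x * ?F j x * (cnj (?F k x) * cnj (?F l x))) \<le>
        norm (?n k * ?n l * ((norm (?F i x))\<^sup>2 + (norm (?F j x))\<^sup>2))" .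
    qed
  qed measurable
qed

text \<open>The four factors form one superposition with frequency p1 + p2 - p3 - p4. The lemma on
  vanishing integrals needs these frequencies uniformly away from 0. This is the use of compactness:
  the disjoint sets K1 + K2 and K3 + K4 are compact, hence at positive distance.\<close>

lemma integral_quartic_eq_0:
  fixes h1 h2 h3 h4 :: "'a::euclidean_space \<Rightarrow> complex"
  assumes h: "integrable lborel h1" "integrable lborel h2" "integrable lborel h3" "integrable lborel h4"
    and K: "compact K1" "compact K2" "compact K3" "compact K4"
    and supp: "\<And>\<xi>. h1 \<xi> \<noteq> 0 \<Longrightarrow> \<xi> \<in> K1" "\<And>\<xi>. h2 \<xi> \<noteq> 0 \<Longrightarrow> \<xi> \<in> K2"
      "\<And>\<xi>. h3 \<xi> \<noteq> 0 \<Longrightarrow> \<xi> \<in> K3" "\<And>\<xi>. h4 \<xi> \<noteq> 0 \<Longrightarrow> \<xi> \<in> K4"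
    and disj: "\<And>p1 p2 p3 p4. p1 \<in> K1 \<Longrightarrow> p2 \<in> K2 \<Longrightarrow> p3 \<in> K3 \<Longrightarrow> p4 \<in> K4 \<Longrightarrow> p1 + p2 \<noteq> p3 + p4"
    and int: "integrable lborel (\<lambda>x. inv_fourier h1 x * inv_fourier h2 x * (cnj (inv_fourier h3 x) * cnj (inv_fourier h4 x)))"
  shows "(LINT x|lborel. inv_fourier h1 x * inv_fourier h2 x * (cnj (inv_fourier h3 x) * cnj (inv_fourier h4 x))) = 0"
proof -
  let ?\<Phi> = "\<lambda>p::('a\<times>'a)\<times>('a\<times>'a). (fst (fst p) + snd (fst p)) + (- fst (snd p) + - snd (snd p))"
  let ?w = "\<lambda>p. (h1 (fst (fst p)) * h2 (snd (fst p))) * (cnj (h3 (fst (snd p))) * cnj (h4 (snd (snd p))))"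
  have c: "integrable lborel (\<lambda>\<xi>. cnj (h3 \<xi>))" "integrable lborel (\<lambda>\<xi>. cnj (h4 \<xi>))" using h by auto
  have w: "integrable lborel ?w"
    by (intro integrable_tensor[OF integrable_tensor[OF h(1,2)] integrable_tensor[OF c]])
  have \<Phi>m: "?\<Phi> \<in> borel_measurable borel"
    by (intro borel_measurable_continuous_onI continuous_intros)
  have 12: "inv_fourier h1 x * inv_fourier h2 x = waves (\<lambda>p. fst p + snd p) (\<lambda>p. h1 (fst p) * h2 (snd p)) x" for x
    unfolding inv_fourier_waves by (subst waves_mult[OF h(1,2)]) auto
  have 34: "cnj (inv_fourier h3 x) * cnj (inv_fourier h4 x) =
      waves (\<lambda>p. - fst p + - snd p) (\<lambda>p. cnj (h3 (fst p)) * cnj (h4 (snd p))) x" for x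
    unfolding inv_fourier_waves cnj_waves by (subst waves_mult[OF c]) auto
  have eq: "inv_fourier h1 x * inv_fourier h2 x * (cnj (inv_fourier h3 x) * cnj (inv_fourier h4 x)) = waves ?\<Phi> ?w x" for x
    unfolding 12 34
    by (subst waves_mult[OF integrable_tensor[OF h(1,2)] integrable_tensor[OF c]])
      (auto intro!: borel_measurable_continuous_onI continuous_intros)
  let ?S = "{x + y | x y. x \<in> K1 \<and> y \<in> K2}" let ?T = "{x + y | x y. x \<in> K3 \<and> y \<in> K4}"
  have "compact ?S" by (rule compact_sums[OF K(1,2)])
  moreover have "closed ?T" by (rule compact_imp_closed[OF compact_sums[OF K(3,4)]])
  moreover have "?S \<inter> ?T = {}" using disj by blast
  ultimately have "\<exists>s>0. \<forall>x\<in>?S. \<forall>y\<in>?T. s \<le> dist x y"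
    by (rule separate_compact_closed)
  then obtain s where s: "s > 0" "\<forall>x\<in>?S. \<forall>y\<in>?T. s \<le> dist x y"
    by (elim exE conjE)
  show ?thesis
    unfolding eq
  proof (rule integral_waves_eq_0[OF w \<Phi>m _ s(1)])
    show "integrable lborel (waves ?\<Phi> ?w)" using int unfolding eq by simp
    fix p assume "?w p \<noteq> 0"
    then have "fst (fst p) + snd (fst p) \<in> ?S" "fst (snd p) + snd (snd p) \<in> ?T" using supp by fastforce+
    with s(2) have "s \<le> dist (fst (fst p) + snd (fst p)) (fst (snd p) + snd (snd p))" by (elim ballE) auto
    then show "s \<le> norm (?\<Phi> p)" by (simp add: dist_norm algebra_simps)
  qed
qed

text \<open>Schur's test for a symmetric 0-1 matrix with row sums at most N: estimate 2 a_i a_j by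
  a_i^2 + a_j^2 and count each square once per neighbour.\<close>

lemma sum_near_diagonal_le:
  fixes a :: "'i \<Rightarrow> real"
  assumes fin: "finite I" and sym: "\<And>i j. R i j \<Longrightarrow> R j i"
    and card: "\<And>i. i \<in> I \<Longrightarrow> card {j \<in> I. R i j} \<le> N"
  shows "(\<Sum>i\<in>I. \<Sum>j\<in>I. of_bool (R i j) * (a i * a j)) \<le> real N * (\<Sum>i\<in>I. (a i)\<^sup>2)"
proof -
  let ?S = "\<Sum>i\<in>I. \<Sum>j\<in>I. of_bool (R i j) * (a i)\<^sup>2"
  have sw: "?S = (\<Sum>i\<in>I. \<Sum>j\<in>I. of_bool (R i j) * (a j)\<^sup>2)"
    by (subst sum.swap) (use sym in \<open>auto intro!: sum.cong\<close>)
  have "2 * (\<Sum>i\<in>I. \<Sum>j\<in>I. of_bool (R i j) * (a i * a j)) \<le> (\<Sum>i\<in>I. \<Sum>j\<in>I. of_bool (R i j) * ((a i)\<^sup>2 + (a j)\<^sup>2))"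
    unfolding sum_distrib_left
    by (intro sum_mono) (use sum_squares_bound in \<open>auto simp: of_bool_def algebra_simps\<close>)
  also have "\<dots> = 2 * ?S"
    using sw by (simp add: distrib_left sum.distrib)
  finally have "(\<Sum>i\<in>I. \<Sum>j\<in>I. of_bool (R i j) * (a i * a j)) \<le> ?S" by simp
  also have "\<dots> = (\<Sum>i\<in>I. real (card {j \<in> I. R i j}) * (a i)\<^sup>2)"
    using fin by (intro sum.cong refl) (simp add: sum_distrib_right[symmetric] Int_def conj_commute)
  also have "\<dots> \<le> (\<Sum>i\<in>I. real N * (a i)\<^sup>2)"
    using card by (intro sum_mono mult_right_mono) auto
  finally show ?thesis by (simp add: sum_distrib_left)
qed

lemma norm_sum_power4:
  fixes F :: "'i \<Rightarrow> complex"
  shows "complex_of_real (norm (\<Sum>i\<in>I. F i) ^ 4) =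
    (\<Sum>i\<in>I. \<Sum>j\<in>I. \<Sum>k\<in>I. \<Sum>l\<in>I. F i * F j * (cnj (F k) * cnj (F l)))"
proof -
  let ?s = "\<Sum>i\<in>I. F i"
  have "complex_of_real (norm ?s ^ 4) = (complex_of_real ((norm ?s)\<^sup>2))\<^sup>2"
    by (simp flip: power_mult)
  also have "\<dots> = (?s * ?s) * (cnj ?s * cnj ?s)"
    unfolding complex_norm_square by (simp add: power2_eq_square mult_ac)
  also have "\<dots> = (\<Sum>i\<in>I. \<Sum>j\<in>I. \<Sum>k\<in>I. \<Sum>l\<in>I. F i * F j * (cnj (F k) * cnj (F l)))"
    unfolding cnj_sum sum_product[of F I F I] sum_product[of "\<lambda>i. cnj (F i)" I "\<lambda>i. cnj (F i)" I]
    by (simp only: sum_distrib_left[of "F _ * F _"] sum_distrib_right)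
  finally show ?thesis .
qed

text \<open>These are the two ways of pairing the first two indices with the last two; exchanging k
  and l shows that they contribute equally.\<close>

lemma sum_product4:
  fixes f :: "'i \<Rightarrow> 'i \<Rightarrow> real"
  shows "(\<Sum>i\<in>I. \<Sum>j\<in>I. \<Sum>k\<in>I. \<Sum>l\<in>I. f i k * f j l) = (\<Sum>i\<in>I. \<Sum>k\<in>I. f i k)\<^sup>2"
    and "(\<Sum>i\<in>I. \<Sum>j\<in>I. \<Sum>k\<in>I. \<Sum>l\<in>I. f i l * f j k) = (\<Sum>i\<in>I. \<Sum>k\<in>I. f i k)\<^sup>2"
proof -
  have "(\<Sum>i\<in>I. \<Sum>j\<in>I. \<Sum>k\<in>I. \<Sum>l\<in>I. f i k * f j l) = (\<Sum>i\<in>I. \<Sum>j\<in>I. (\<Sum>k\<in>I. f i k) * (\<Sum>l\<in>I. f j l))"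
    by (simp add: sum_product)
  then show *: "(\<Sum>i\<in>I. \<Sum>j\<in>I. \<Sum>k\<in>I. \<Sum>l\<in>I. f i k * f j l) = (\<Sum>i\<in>I. \<Sum>k\<in>I. f i k)\<^sup>2"
    by (simp add: power2_eq_square sum_product)
  have "(\<Sum>k\<in>I. \<Sum>l\<in>I. f i l * f j k) = (\<Sum>k\<in>I. \<Sum>l\<in>I. f i k * f j l)" for i j
    by (rule sum.swap)
  with * show "(\<Sum>i\<in>I. \<Sum>j\<in>I. \<Sum>k\<in>I. \<Sum>l\<in>I. f i l * f j k) = (\<Sum>i\<in>I. \<Sum>k\<in>I. f i k)\<^sup>2"
    by simp
qed

lemma
  fixes f :: "'i \<Rightarrow> 'i \<Rightarrow> 'i \<Rightarrow> 'i \<Rightarrow> 'a \<Rightarrow> 'b::{banach, second_countable_topology}"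
  assumes f: "\<And>i j k l. i \<in> I \<Longrightarrow> j \<in> I \<Longrightarrow> k \<in> I \<Longrightarrow> l \<in> I \<Longrightarrow> integrable M (f i j k l)"
  shows integrable_sum4: "integrable M (\<lambda>x. \<Sum>i\<in>I. \<Sum>j\<in>I. \<Sum>k\<in>I. \<Sum>l\<in>I. f i j k l x)"
    and integral_sum4: "(LINT x|M. (\<Sum>i\<in>I. \<Sum>j\<in>I. \<Sum>k\<in>I. \<Sum>l\<in>I. f i j k l x)) =
      (\<Sum>i\<in>I. \<Sum>j\<in>I. \<Sum>k\<in>I. \<Sum>l\<in>I. LINT x|M. f i j k l x)"
  using f by simp_all

text \<open>The Cordoba-Fefferman argument, with the geometry hidden in a relation \<open>R\<close>
  of nearness. Non-resonant quadruples integrate to 0, and only afterwards are absolute values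
  taken. Each pairing then splits into two independent near-diagonal sums; bounding each by N times
  the sum of squares gives N^2, and the two pairings give the 2.\<close>

theorem fourth_moment_le_square_function:
  fixes h :: "'i \<Rightarrow> 'a::euclidean_space \<Rightarrow> complex"
  assumes fin: "finite I"
    and h: "\<And>i. i \<in> I \<Longrightarrow> integrable lborel (h i)" and bound: "\<And>i \<xi>. i \<in> I \<Longrightarrow> norm (h i \<xi>) \<le> B"
    and K: "\<And>i. i \<in> I \<Longrightarrow> compact (K i)" and supp: "\<And>i \<xi>. i \<in> I \<Longrightarrow> h i \<xi> \<noteq> 0 \<Longrightarrow> \<xi> \<in> K i"
    and sym: "\<And>i j. R i j \<Longrightarrow> R j i"
    and card: "\<And>i. i \<in> I \<Longrightarrow> card {j \<in> I. R i j} \<le> N"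
    and quad: "\<And>i j k l p q s t. i \<in> I \<Longrightarrow> j \<in> I \<Longrightarrow> k \<in> I \<Longrightarrow> l \<in> I \<Longrightarrow>
      p \<in> K i \<Longrightarrow> q \<in> K j \<Longrightarrow> s \<in> K k \<Longrightarrow> t \<in> K l \<Longrightarrow> p + q = s + t \<Longrightarrow>
      R i k \<and> R j l \<or> R i l \<and> R j k"
  shows "(LINT x|lborel. norm (\<Sum>i\<in>I. inv_fourier (h i) x) ^ 4) \<le>
    2 * (real N)\<^sup>2 * (LINT x|lborel. (\<Sum>i\<in>I. (norm (inv_fourier (h i) x))\<^sup>2)\<^sup>2)"
proof -
  let ?F = "\<lambda>i. inv_fourier (h i)"
  let ?P = "\<lambda>i j k l x. ?F i x * ?F j x * (cnj (?F k x) * cnj (?F l x))"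
  let ?G = "\<lambda>i j k l. of_bool (R i k \<and> R j l \<or> R i l \<and> R j k) :: real"
  have int: "integrable lborel (?P i j k l)" if "i \<in> I" "j \<in> I" "k \<in> I" "l \<in> I" for i j k l
    using inv_fourier_quartic_integrable[OF h bound that] .
  \<comment> \<open>\<open>?G\<close> marks the index quadruples that \<open>quad\<close> permits.
    Inserting it under the integral costs nothing, since the remaining quartic integrals vanish
    exactly.\<close>
  have zero: "norm (LINT x|lborel. ?P i j k l x) \<le> (LINT x|lborel. ?G i j k l * norm (?P i j k l x))"
    if I: "i \<in> I" "j \<in> I" "k \<in> I" "l \<in> I" for i j k l
  proof (cases "R i k \<and> R j l \<or> R i l \<and> R j k")
    case True
    then show ?thesis using integral_norm_bound[of lborel "?P i j k l"] by simp
  next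
    case False
    have "p + q \<noteq> s + t" if "p \<in> K i" "q \<in> K j" "s \<in> K k" "t \<in> K l" for p q s t
      using quad[OF I that] False by blast
    from integral_quartic_eq_0[OF h[OF I(1)] h[OF I(2)] h[OF I(3)] h[OF I(4)]
        K[OF I(1)] K[OF I(2)] K[OF I(3)] K[OF I(4)]
        supp[OF I(1)] supp[OF I(2)] supp[OF I(3)] supp[OF I(4)] this int[OF I]]
    have "(LINT x|lborel. ?P i j k l x) = 0" .
    then show ?thesis using False by simp
  qed
  have intG: "integrable lborel (\<lambda>x. ?G i j k l * norm (?P i j k l x))"
    if "i \<in> I" "j \<in> I" "k \<in> I" "l \<in> I" for i j k l
    using int[OF that] by (intro integrable_mult_right integrable_norm)
  have intS: "integrable lborel (\<lambda>x. (\<Sum>i\<in>I. (norm (?F i x))\<^sup>2)\<^sup>2)"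
  proof -
    have "integrable lborel (\<lambda>x. \<Sum>i\<in>I. \<Sum>j\<in>I. norm (?P i j i j x))"
      using int by (intro Bochner_Integration.integrable_sum integrable_norm)
    moreover have "(\<Sum>i\<in>I. (norm (?F i x))\<^sup>2)\<^sup>2 = (\<Sum>i\<in>I. \<Sum>j\<in>I. norm (?P i j i j x))" for x
      by (simp add: power2_eq_square sum_product norm_mult mult.assoc mult.left_commute)
    ultimately show ?thesis by simp
  qed
  have "(LINT x|lborel. norm (\<Sum>i\<in>I. ?F i x) ^ 4) \<le> norm (complex_of_real (LINT x|lborel. norm (\<Sum>i\<in>I. ?F i x) ^ 4))"
    by simp
  also have "complex_of_real (LINT x|lborel. norm (\<Sum>i\<in>I. ?F i x) ^ 4) =
      (LINT x|lborel. (\<Sum>i\<in>I. \<Sum>j\<in>I. \<Sum>k\<in>I. \<Sum>l\<in>I. ?P i j k l x))"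
    unfolding integral_complex_of_real[symmetric] norm_sum_power4 ..
  also have "\<dots> = (\<Sum>i\<in>I. \<Sum>j\<in>I. \<Sum>k\<in>I. \<Sum>l\<in>I. LINT x|lborel. ?P i j k l x)"
    by (rule integral_sum4[OF int])
  also have "norm \<dots> \<le> (\<Sum>i\<in>I. \<Sum>j\<in>I. \<Sum>k\<in>I. \<Sum>l\<in>I. LINT x|lborel. ?G i j k l * norm (?P i j k l x))"
    by (intro sum_norm_le zero)
  also have "\<dots> = (LINT x|lborel. (\<Sum>i\<in>I. \<Sum>j\<in>I. \<Sum>k\<in>I. \<Sum>l\<in>I. ?G i j k l * norm (?P i j k l x)))"
    by (rule integral_sum4[OF intG, symmetric])
  also have "\<dots> \<le> (LINT x|lborel. 2 * (real N)\<^sup>2 * (\<Sum>i\<in>I. (norm (?F i x))\<^sup>2)\<^sup>2)"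
  proof (rule integral_mono)
    show "integrable lborel (\<lambda>x. \<Sum>i\<in>I. \<Sum>j\<in>I. \<Sum>k\<in>I. \<Sum>l\<in>I. ?G i j k l * norm (?P i j k l x))"
      by (rule integrable_sum4[OF intG])
    show "integrable lborel (\<lambda>x. 2 * (real N)\<^sup>2 * (\<Sum>i\<in>I. (norm (?F i x))\<^sup>2)\<^sup>2)"
      using intS by (rule integrable_mult_right)
    fix x
    let ?a = "\<lambda>i. norm (?F i x)"
    let ?f = "\<lambda>i k. of_bool (R i k) * (?a i * ?a k)"
    have "(\<Sum>i\<in>I. \<Sum>j\<in>I. \<Sum>k\<in>I. \<Sum>l\<in>I. ?G i j k l * norm (?P i j k l x)) \<le>
        (\<Sum>i\<in>I. \<Sum>j\<in>I. \<Sum>k\<in>I. \<Sum>l\<in>I. ?f i k * ?f j l + ?f i l * ?f j k)"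
    proof (intro sum_mono)
      fix i j k l
      have eq: "?f i k * ?f j l = of_bool (R i k \<and> R j l) * norm (?P i j k l x)"
        "?f i l * ?f j k = of_bool (R i l \<and> R j k) * norm (?P i j k l x)"
        by (simp_all add: norm_mult of_bool_conj mult_ac)
      show "?G i j k l * norm (?P i j k l x) \<le> ?f i k * ?f j l + ?f i l * ?f j k"
        unfolding eq distrib_right[symmetric] by (intro mult_right_mono) (auto simp: of_bool_def)
    qed
    also have "\<dots> = 2 * (\<Sum>i\<in>I. \<Sum>k\<in>I. ?f i k)\<^sup>2"
      unfolding sum.distrib sum_product4 by simp
    also have "\<dots> \<le> 2 * (real N * (\<Sum>i\<in>I. (?a i)\<^sup>2))\<^sup>2"
      by (intro mult_left_mono power_mono sum_near_diagonal_le[OF fin sym card] sum_nonneg) auto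
    finally show "(\<Sum>i\<in>I. \<Sum>j\<in>I. \<Sum>k\<in>I. \<Sum>l\<in>I. ?G i j k l * norm (?P i j k l x)) \<le>
        2 * (real N)\<^sup>2 * (\<Sum>i\<in>I. (?a i)\<^sup>2)\<^sup>2"
      by (simp add: power_mult_distrib)
  qed
  also have "\<dots> = 2 * (real N)\<^sup>2 * (LINT x|lborel. (\<Sum>i\<in>I. (norm (?F i x))\<^sup>2)\<^sup>2)"
    by (rule integral_mult_right_zero)
  finally show ?thesis .
qed

subsection \<open>Schwartz functions\<close>

lemma smooth_continuous: "smooth f \<Longrightarrow> continuous_on UNIV f"
  unfolding smooth_def
  by (metis continuous_at_imp_continuous_on differentiable_imp_continuous_within iter_deriv.simps(1) lists.Nil)

lemma schwartz_bounded: "schwartz f \<Longrightarrow> \<exists>B. \<forall>x. norm x ^ N * norm (f x) \<le> B"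
  unfolding schwartz_def by (metis iter_deriv.simps(1) lists.Nil)

text \<open>The majorant is a product of the integrable functions 1 / (1 + t^2), one per coordinate.
  The product of the denominators grows at most like \<open>norm x ^ (2 * DIM('a))\<close>, which
  fixes the order of decay requested from the Schwartz condition.\<close>

lemma schwartz_integrable:
  fixes f :: "'a::euclidean_space \<Rightarrow> complex"
  assumes f: "schwartz f"
  shows "integrable lborel f"
proof -
  have "continuous_on UNIV f" using f smooth_continuous by (auto simp: schwartz_def)
  then have [measurable]: "f \<in> borel_measurable borel" by (rule borel_measurable_continuous_onI)
  obtain B0 where B0: "\<And>x. norm (f x) \<le> B0" using schwartz_bounded[OF f, of 0] by auto
  obtain B1 where B1: "\<And>x. norm x ^ (2 * DIM('a)) * norm (f x) \<le> B1" using schwartz_bounded[OF f] by blast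
  let ?g = "\<lambda>t::real. complex_of_real (1 / (1 + t\<^sup>2))"
  have "integrable lborel ?g"
    using integrable_inverse_1_plus_square unfolding set_integrable_def
    by (subst complex_of_real_integrable_eq) (simp add: inverse_eq_divide)
  then have int: "integrable lborel (\<lambda>x::'a. \<Prod>b\<in>Basis. ?g (x \<bullet> b))"
    by (intro integrable_lborel_prod)
  have bd: "norm (f x) \<le> norm (2 ^ DIM('a) * (B0 + B1) * (\<Prod>b\<in>Basis. ?g (x \<bullet> b)))" for x :: 'a
  proof -
    let ?p = "\<Prod>b\<in>Basis. 1 + (x \<bullet> b)\<^sup>2"
    have p0: "?p > 0" by (intro prod_pos) (auto intro: add_pos_nonneg)
    have "?p \<le> (\<Prod>b\<in>(Basis::'a set). 1 + (norm x)\<^sup>2)"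
      using Basis_le_norm[of _ x] by (intro prod_mono) (auto intro: abs_le_square_iff[THEN iffD1])
    also have "\<dots> = (1 + (norm x)\<^sup>2) ^ DIM('a)" by simp
    also have "\<dots> \<le> 2 ^ DIM('a) * (1 + norm x ^ (2 * DIM('a)))"
    proof (cases "norm x \<le> 1")
      case True
      then have "(norm x)\<^sup>2 \<le> 1" by (simp add: power_le_one)
      then have "(1 + (norm x)\<^sup>2) ^ DIM('a) \<le> 2 ^ DIM('a)" by (intro power_mono) auto
      also have "\<dots> \<le> 2 ^ DIM('a) * (1 + norm x ^ (2 * DIM('a)))" by simp
      finally show ?thesis .
    next
      case False
      then have "1 \<le> (norm x)\<^sup>2" by (simp add: one_le_power)
      then have "(1 + (norm x)\<^sup>2) ^ DIM('a) \<le> (2 * (norm x)\<^sup>2) ^ DIM('a)" by (intro power_mono) auto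
      also have "\<dots> \<le> 2 ^ DIM('a) * (1 + norm x ^ (2 * DIM('a)))"
        by (simp add: power_mult_distrib power_mult[symmetric])
      finally show ?thesis .
    qed
    finally have "?p * norm (f x) \<le> 2 ^ DIM('a) * (1 + norm x ^ (2 * DIM('a))) * norm (f x)"
      by (rule mult_right_mono) simp
    also have "\<dots> \<le> 2 ^ DIM('a) * (B0 + B1)"
      using B0[of x] B1[of x] by (simp add: mult.assoc distrib_right)
    finally have "norm (f x) \<le> 2 ^ DIM('a) * (B0 + B1) / ?p"
      using p0 by (simp add: field_simps)
    also have "\<dots> = 2 ^ DIM('a) * (B0 + B1) * (\<Prod>b\<in>Basis. 1 / (1 + (x \<bullet> b)\<^sup>2))"
      by (simp add: prod_dividef)
    also have "\<dots> \<le> \<bar>2 ^ DIM('a) * (B0 + B1) * (\<Prod>b\<in>Basis. 1 / (1 + (x \<bullet> b)\<^sup>2))\<bar>"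
      by (rule abs_ge_self)
    also have "\<dots> = norm (complex_of_real (2 ^ DIM('a) * (B0 + B1) * (\<Prod>b\<in>Basis. 1 / (1 + (x \<bullet> b)\<^sup>2))))"
      by (simp only: norm_of_real)
    finally show ?thesis by simp
  qed
  have "integrable lborel (\<lambda>x::'a. complex_of_real (2 ^ DIM('a) * (B0 + B1)) * (\<Prod>b\<in>Basis. ?g (x \<bullet> b)))"
    using int by (rule integrable_mult_right)
  then show ?thesis
    by (rule Bochner_Integration.integrable_bound) (use bd in auto)
qed

subsection \<open>Geometry of the canonical boxes\<close>

lemma inner_symmetric_matrix:
  fixes A :: "real^'n^'n"
  assumes "transpose A = A"
  shows "x \<bullet> (A *v y) = (A *v x) \<bullet> y"
  using assms by (metis dot_lmul_matrix transpose_matrix_vector)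

lemma quad_map_has_derivative:
  fixes A :: "'l::finite \<Rightarrow> real^'d^'d"
  assumes sym: "\<And>k. transpose (A k) = A k"
  shows "(quad_map A b c has_derivative (\<lambda>v. \<chi> k. (A k *v \<eta> + b k) \<bullet> v)) (at \<eta>)"
proof -
  have "((\<lambda>\<xi>. quad_map A b c \<xi> \<bullet> axis k 1) has_derivative (\<lambda>v. (\<chi> k. (A k *v \<eta> + b k) \<bullet> v) \<bullet> axis k 1)) (at \<eta>)" for k
  proof -
    have "((\<lambda>\<xi>. 1/2 * (\<xi> \<bullet> (A k *v \<xi>)) + b k \<bullet> \<xi> + c k) has_derivative
        (\<lambda>v. 1/2 * (\<eta> \<bullet> (A k *v v) + v \<bullet> (A k *v \<eta>)) + b k \<bullet> v + 0)) (at \<eta>)"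
      by (intro has_derivative_add has_derivative_mult_right has_derivative_inner has_derivative_inner_right
          has_derivative_const has_derivative_ident
          bounded_linear_imp_has_derivative[OF matrix_vector_mul_bounded_linear])
    moreover have "1/2 * (\<eta> \<bullet> (A k *v v) + v \<bullet> (A k *v \<eta>)) + b k \<bullet> v + 0 = (A k *v \<eta> + b k) \<bullet> v" for v
      using inner_symmetric_matrix[OF sym, of \<eta> k v] inner_commute[of v "A k *v \<eta>"]
      by (simp add: inner_add_left)
    ultimately show ?thesis
      by (simp only: quad_map_def inner_axis vec_lambda_beta inner_real_def mult_1_right)
  qed
  then show ?thesis
    by (subst has_derivative_componentwise_within) (auto simp: Basis_vec_def)
qed

context
  fixes A :: "'l::finite \<Rightarrow> real^'d^'d" and b :: "'l \<Rightarrow> real^'d" and c :: "'l \<Rightarrow> real"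
  assumes sym: "\<And>k. transpose (A k) = A k"
begin

text \<open>Symmetry of \<open>A k\<close> makes this the gradient of the k-th component; in
  general, half the sum of \<open>A k\<close> and its transpose would appear in place of
  \<open>A k\<close>.\<close>

abbreviation "grad k \<eta> \<equiv> A k *v \<eta> + b k"

lemma tangent_vec_quad_map:
  "tangent_vec (quad_map A b c) \<eta> i = (axis i 1, \<chi> k. grad k \<eta> \<bullet> axis i 1)"
proof -
  have "(graph_map (quad_map A b c) has_derivative (\<lambda>v. (v, \<chi> k. grad k \<eta> \<bullet> v))) (at \<eta>)"
    unfolding graph_map_def
    by (intro has_derivative_Pair has_derivative_ident quad_map_has_derivative sym)
  then show ?thesis
    unfolding tangent_vec_def dir_deriv_def by (simp add: frechet_derivative_at[symmetric])
qed

lemma normal_vec_quad_map: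
  "normal_vec (quad_map A b c) \<eta> j = (- grad j \<eta>, axis j 1)"
proof -
  have "((\<lambda>\<xi>. quad_map A b c \<xi> $ j) has_derivative (\<lambda>v. (\<chi> k. grad k \<eta> \<bullet> v) $ j)) (at \<eta>)"
    by (rule bounded_linear.has_derivative[OF bounded_linear_vec_nth quad_map_has_derivative[OF sym]])
  then have "frechet_derivative (\<lambda>\<xi>. quad_map A b c \<xi> $ j) (at \<eta>) = (\<lambda>v. grad j \<eta> \<bullet> v)"
    by (simp add: frechet_derivative_at[symmetric])
  then show ?thesis
    unfolding normal_vec_def dir_deriv_def by (simp add: vec_eq_iff inner_axis)
qed

lemma quad_map_taylor:
  "quad_map A b c (\<eta> + w) $ k = quad_map A b c \<eta> $ k + grad k \<eta> \<bullet> w + 1/2 * (w \<bullet> (A k *v w))"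
  unfolding quad_map_def
  by (simp add: matrix_vector_right_distrib inner_add_left inner_add_right
      inner_symmetric_matrix[OF sym, of \<eta> k w] inner_commute[of w "A k *v \<eta>"] field_simps)

lemma matrix_family_bounded: "\<exists>L\<ge>0. \<forall>k v. norm (A k *v v) \<le> L * norm v"
proof (intro exI[of _ "\<Sum>k\<in>UNIV. onorm ((*v) (A k))"] conjI allI)
  have bl: "bounded_linear ((*v) (A k))" for k by (rule matrix_vector_mul_bounded_linear)
  show "0 \<le> (\<Sum>k\<in>UNIV. onorm ((*v) (A k)))" by (intro sum_nonneg onorm_pos_le bl)
  fix k v
  have "onorm ((*v) (A k)) \<le> (\<Sum>k\<in>UNIV. onorm ((*v) (A k)))"
    by (rule member_le_sum) (auto intro: onorm_pos_le bl)
  then show "norm (A k *v v) \<le> (\<Sum>k\<in>UNIV. onorm ((*v) (A k))) * norm v"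
    using onorm[OF bl, of k v] by (meson mult_right_mono norm_ge_zero order_trans)
qed

lemma grad_bounded: "\<exists>G\<ge>0. \<forall>k. \<forall>\<eta>\<in>ball 0 1. norm (grad k \<eta>) \<le> G"
proof -
  obtain L where L: "L \<ge> 0" "\<And>k v. norm (A k *v v) \<le> L * norm v" using matrix_family_bounded by auto
  show ?thesis
  proof (intro exI[of _ "L + (\<Sum>k\<in>UNIV. norm (b k))"] conjI allI ballI)
    show "0 \<le> L + (\<Sum>k\<in>UNIV. norm (b k))" using L(1) by (intro add_nonneg_nonneg sum_nonneg) auto
    fix k and \<eta> :: "real^'d" assume "\<eta> \<in> ball 0 1"
    then have "L * norm \<eta> \<le> L * 1" using L(1) by (intro mult_left_mono) auto
    moreover have "norm (b k) \<le> (\<Sum>k\<in>UNIV. norm (b k))" by (rule member_le_sum) auto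
    ultimately show "norm (grad k \<eta>) \<le> L + (\<Sum>k\<in>UNIV. norm (b k))"
      using norm_triangle_ineq[of "A k *v \<eta>" "b k"] L(2)[of k \<eta>] by linarith
  qed
qed

text \<open>A tangential step of length O(1/r) follows the graph to first order, leaving a quadratic
  error O(1/r^2). A normal step of size O(1/r^2) shifts the base point by only that much, and the
  bounded gradient turns this into a height change of the same order.\<close>

lemma canonical_box_near_graph:
  assumes D: "D \<ge> 0"
  shows "\<exists>K\<ge>0. \<forall>r \<eta> p. r \<ge> 1 \<and> \<eta> \<in> ball 0 1 \<and> p \<in> canonical_box D (quad_map A b c) r \<eta> \<longrightarrow>
    norm (fst p - \<eta>) \<le> K / r \<and> (\<forall>k. \<bar>snd p $ k - quad_map A b c (fst p) $ k\<bar> \<le> K / r\<^sup>2)"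
proof -
  obtain L where L: "L \<ge> 0" "\<And>k v. norm (A k *v v) \<le> L * norm v" using matrix_family_bounded by auto
  obtain G where G: "G \<ge> 0" "\<And>k \<eta>. \<eta> \<in> ball 0 1 \<Longrightarrow> norm (grad k \<eta>) \<le> G" using grad_bounded by auto
  define d where "d = real CARD('d)"
  define l where "l = real CARD('l)"
  \<comment> \<open>\<open>K1\<close> adds the tangential and the horizontal normal displacement,
    with 1/r^2 absorbed into 1/r because r \<ge> 1. \<open>K2\<close> collects the three terms of
    the height difference: the vertical coefficient, the gradient applied to \<open>e\<close>, and
    the second-order term (its factor 1/2 dropped).\<close>
  define K1 where "K1 = d * D + l * D * G"
  define K2 where "K2 = D + l * D * G * G + L * K1\<^sup>2"
  have nn: "d \<ge> 0" "l \<ge> 0" "K1 \<ge> 0" "K2 \<ge> 0" using D G(1) L(1) by (auto simp: d_def l_def K1_def K2_def)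
  show ?thesis
  proof (intro exI[of _ "max K1 K2"] conjI allI impI)
    show "0 \<le> max K1 K2" using nn by simp
    fix r \<eta> p k assume *: "r \<ge> 1 \<and> \<eta> \<in> ball 0 1 \<and> p \<in> canonical_box D (quad_map A b c) r \<eta>"
    then have r: "r \<ge> 1" and \<eta>: "\<eta> \<in> ball 0 1" by auto
    from * obtain x y where p: "p = graph_map (quad_map A b c) \<eta>
        + (\<Sum>i\<in>UNIV. x i *\<^sub>R tangent_vec (quad_map A b c) \<eta> i)
        + (\<Sum>j\<in>UNIV. y j *\<^sub>R normal_vec (quad_map A b c) \<eta> j)"
      and x: "\<And>i. \<bar>x i\<bar> \<le> D / r" and y: "\<And>j. \<bar>y j\<bar> \<le> D / r\<^sup>2"
      unfolding canonical_box_def by auto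
    define a where "a = (\<Sum>i\<in>UNIV. x i *\<^sub>R axis i (1::real))"
    define e where "e = (\<Sum>j\<in>UNIV. y j *\<^sub>R grad j \<eta>)"
    define w where "w = a - e"
    have fp: "fst p = \<eta> + w"
      by (simp add: p graph_map_def tangent_vec_quad_map normal_vec_quad_map fst_sum w_def a_def e_def sum_negf del: minus_add_distrib)
    have sp: "snd p $ k = quad_map A b c \<eta> $ k + grad k \<eta> \<bullet> a + y k" for k
    proof -
      have "(\<Sum>j\<in>UNIV. y j * axis j 1 $ k) = y k"
        by (subst sum.remove[of UNIV k]) (auto simp: axis_def)
      then show ?thesis
        by (simp add: p graph_map_def tangent_vec_quad_map normal_vec_quad_map snd_sum a_def
            inner_sum_right)
    qed
    have na: "norm a \<le> d * D / r"
    proof -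
      have "norm a \<le> (\<Sum>i\<in>(UNIV::'d set). D / r)"
        unfolding a_def using x by (intro sum_norm_le) (simp add: norm_axis_1)
      then show ?thesis by (simp add: d_def)
    qed
    have ne: "norm e \<le> l * D * G / r\<^sup>2"
    proof -
      have "norm e \<le> (\<Sum>j\<in>(UNIV::'l set). D / r\<^sup>2 * G)"
        unfolding e_def
      proof (intro sum_norm_le)
        show "norm (y j *\<^sub>R grad j \<eta>) \<le> D / r\<^sup>2 * G" for j
          unfolding norm_scaleR using y[of j] G(2)[OF \<eta>, of j] D by (intro mult_mono) auto
      qed
      then show ?thesis by (simp add: l_def)
    qed
    have "l * D * G / r\<^sup>2 \<le> l * D * G / r"
      using r nn D G(1) by (intro divide_left_mono) (auto simp: power2_eq_square)
    then have nw: "norm w \<le> K1 / r"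
      using na ne norm_triangle_ineq4[of a e] by (simp add: w_def K1_def add_divide_distrib)
    also have "\<dots> \<le> max K1 K2 / r" using r by (simp add: divide_right_mono)
    finally show "norm (fst p - \<eta>) \<le> max K1 K2 / r" by (simp add: fp)
    have "\<bar>grad k \<eta> \<bullet> e\<bar> \<le> G * (l * D * G / r\<^sup>2)"
      using Cauchy_Schwarz_ineq2[of "grad k \<eta>" e] G(2)[OF \<eta>, of k] ne G(1)
      by (meson mult_mono norm_ge_zero order_trans)
    moreover have "\<bar>w \<bullet> (A k *v w)\<bar> \<le> K1 / r * (L * (K1 / r))"
    proof -
      have "norm (A k *v w) \<le> L * (K1 / r)"
        using L(2)[of k w] mult_left_mono[OF nw L(1)] by linarith
      then show ?thesis
        using Cauchy_Schwarz_ineq2[of w "A k *v w"] nw nn r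
        by (meson divide_nonneg_pos mult_mono norm_ge_zero order_trans less_le_trans zero_less_one)
    qed
    moreover have "snd p $ k - quad_map A b c (fst p) $ k = y k + grad k \<eta> \<bullet> e - 1/2 * (w \<bullet> (A k *v w))"
      unfolding fp sp quad_map_taylor by (simp add: w_def inner_diff_right)
    moreover have "D / r\<^sup>2 + G * (l * D * G / r\<^sup>2) + K1 / r * (L * (K1 / r)) = K2 / r\<^sup>2"
      by (simp add: K2_def add_divide_distrib power2_eq_square mult_ac)
    ultimately have "\<bar>snd p $ k - quad_map A b c (fst p) $ k\<bar> \<le> K2 / r\<^sup>2"
      using y[of k] by linarith
    also have "\<dots> \<le> max K1 K2 / r\<^sup>2" by (simp add: divide_right_mono)
    finally show "\<bar>snd p $ k - quad_map A b c (fst p) $ k\<bar> \<le> max K1 K2 / r\<^sup>2" .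
  qed
qed

text \<open>The left side is a second difference along the sides of a parallelogram with vertex
  \<xi>1. Constants and linear terms cancel, and the quadratic terms leave only the mixed product of
  the two sides.\<close>

lemma quad_map_parallelogram:
  assumes "\<xi>1 + \<xi>2 = \<xi>3 + \<xi>4"
  shows "quad_map A b c \<xi>1 $ k + quad_map A b c \<xi>2 $ k - quad_map A b c \<xi>3 $ k - quad_map A b c \<xi>4 $ k =
    (\<xi>1 - \<xi>3) \<bullet> (A k *v (\<xi>1 - \<xi>4))"
proof -
  define w v where "w = \<xi>3 - \<xi>1" and "v = \<xi>4 - \<xi>1"
  have "\<xi>3 = \<xi>1 + w" "\<xi>4 = \<xi>1 + v" "\<xi>2 = \<xi>1 + (w + v)"
    using assms by (auto simp: w_def v_def algebra_simps)
  then show ?thesis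
    by (simp only: quad_map_taylor)
      (simp add: inner_add_left inner_add_right matrix_vector_right_distrib inner_symmetric_matrix[OF sym, of v k w]
        inner_commute[of _ w] field_simps linear_neg[OF matrix_vector_mul_linear])
qed

text \<open>A zero at unit vectors w and v would make v orthogonal to every \<open>A k *v w\<close>,
  yet some of these are the columns of an invertible matrix. So the sum is positive on the product
  of two unit spheres, where it attains a minimum \<mu>; homogeneity does the rest.\<close>

lemma nondegenerate_bilinear:
  assumes nondeg: "\<And>\<nu>::real^'d. norm \<nu> = 1 \<Longrightarrow> \<exists>i::'d \<Rightarrow> 'l. det (\<chi> p m. (A (i m) *v \<nu>) $ p) \<noteq> 0"
  shows "\<exists>\<mu>>0. \<forall>w v. \<mu> * (norm w * norm v) \<le> (\<Sum>k\<in>UNIV. \<bar>w \<bullet> (A k *v v)\<bar>)"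
proof -
  let ?g = "\<lambda>p::(real^'d)\<times>(real^'d). \<Sum>k\<in>UNIV. \<bar>fst p \<bullet> (A k *v snd p)\<bar>"
  let ?S = "sphere (0::real^'d) 1"
  have cont: "continuous_on (?S \<times> ?S) ?g"
    by (intro continuous_intros bounded_linear.continuous_on[OF matrix_vector_mul_bounded_linear])
  \<comment> \<open>Any coordinate direction shows that the sphere is nonempty, as needed for the
    minimum to be attained.\<close>
  have "axis undefined 1 \<in> ?S" by (simp add: norm_axis_1)
  then have "?S \<times> ?S \<noteq> {}" by blast
  moreover have "compact (?S \<times> ?S)" by (intro compact_Times compact_sphere)
  ultimately obtain q where q: "q \<in> ?S \<times> ?S" "\<And>p. p \<in> ?S \<times> ?S \<Longrightarrow> ?g q \<le> ?g p"
    using continuous_attains_inf[OF _ _ cont] by blast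
  obtain w0 v0 where q0: "q = (w0, v0)" by (cases q)
  have n0: "norm w0 = 1" "norm v0 = 1" using q(1) by (auto simp: q0)
  have pos: "?g q > 0"
  proof (rule ccontr)
    assume "\<not> ?g q > 0"
    then have "?g q = 0" by (intro antisym sum_nonneg) auto
    then have z: "w0 \<bullet> (A k *v v0) = 0" for k
      by (subst (asm) sum_nonneg_eq_0_iff) (auto simp: q0)
    obtain i where i: "det (\<chi> p m. (A (i m) *v w0) $ p) \<noteq> 0" using nondeg n0 by blast
    let ?M = "\<chi> p m. (A (i m) *v w0) $ p"
    have "transpose ?M *v v0 = 0"
      using z inner_symmetric_matrix[OF sym, of w0 _ v0]
      by (simp add: vec_eq_iff matrix_vector_mult_def transpose_def inner_vec_def)
    moreover have "invertible (transpose ?M)" using i by (simp add: invertible_det_nz det_transpose)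
    ultimately have "v0 = 0"
      by (metis invertible_def matrix_left_invertible_ker)
    then show False using n0 by simp
  qed
  show ?thesis
  proof (intro exI[of _ "?g q"] conjI allI pos)
    fix w v :: "real^'d"
    show "?g q * (norm w * norm v) \<le> (\<Sum>k\<in>UNIV. \<bar>w \<bullet> (A k *v v)\<bar>)"
    proof (cases "w = 0 \<or> v = 0")
      case False
      define w' v' where "w' = w /\<^sub>R norm w" and "v' = v /\<^sub>R norm v"
      have wv: "w = norm w *\<^sub>R w'" "v = norm v *\<^sub>R v'" using False by (auto simp: w'_def v'_def)
      have "?g q \<le> ?g (w', v')" using False by (intro q(2)) (auto simp: w'_def v'_def)
      then have "?g q * (norm w * norm v) \<le> ?g (w', v') * (norm w * norm v)"
        by (intro mult_right_mono) auto
      also have "\<dots> = (\<Sum>k\<in>UNIV. \<bar>(norm w *\<^sub>R w') \<bullet> (A k *v (norm v *\<^sub>R v'))\<bar>)"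
        unfolding sum_distrib_right
        by (intro sum.cong refl) (simp add: abs_mult matrix_vector_mult_scaleR mult_ac)
      finally show ?thesis using wv by simp
    qed auto
  qed
qed

lemma additive_quadruples:
  assumes D: "D \<ge> 0"
    and nondeg: "\<And>\<nu>::real^'d. norm \<nu> = 1 \<Longrightarrow> \<exists>i::'d \<Rightarrow> 'l. det (\<chi> p m. (A (i m) *v \<nu>) $ p) \<noteq> 0"
  obtains K where "\<And>r \<eta>1 \<eta>2 \<eta>3 \<eta>4 p1 p2 p3 p4. r \<ge> 1 \<Longrightarrow>
    \<eta>1 \<in> ball 0 1 \<Longrightarrow> \<eta>2 \<in> ball 0 1 \<Longrightarrow> \<eta>3 \<in> ball 0 1 \<Longrightarrow> \<eta>4 \<in> ball 0 1 \<Longrightarrow>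
    p1 \<in> canonical_box D (quad_map A b c) r \<eta>1 \<Longrightarrow> p2 \<in> canonical_box D (quad_map A b c) r \<eta>2 \<Longrightarrow>
    p3 \<in> canonical_box D (quad_map A b c) r \<eta>3 \<Longrightarrow> p4 \<in> canonical_box D (quad_map A b c) r \<eta>4 \<Longrightarrow>
    p1 + p2 = p3 + p4 \<Longrightarrow>
    norm (\<eta>1 - \<eta>3) \<le> K / r \<and> norm (\<eta>2 - \<eta>4) \<le> K / r \<or> norm (\<eta>1 - \<eta>4) \<le> K / r \<and> norm (\<eta>2 - \<eta>3) \<le> K / r"
proof -
  let ?Q = "quad_map A b c"
  obtain K where K: "K \<ge> 0" and near: "\<And>r \<eta> p. r \<ge> 1 \<Longrightarrow> \<eta> \<in> ball 0 1 \<Longrightarrow> p \<in> canonical_box D ?Q r \<eta> \<Longrightarrow>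
      norm (fst p - \<eta>) \<le> K / r \<and> (\<forall>k. \<bar>snd p $ k - ?Q (fst p) $ k\<bar> \<le> K / r\<^sup>2)"
    using canonical_box_near_graph[OF D] by blast
  obtain \<mu> where \<mu>: "\<mu> > 0" "\<And>w v. \<mu> * (norm w * norm v) \<le> (\<Sum>k\<in>UNIV. \<bar>w \<bullet> (A k *v v)\<bar>)"
    using nondegenerate_bilinear[OF nondeg] by blast
  \<comment> \<open>Four box errors of size K / r^2 in each of the CARD('l) components bound \<mu>
    times the product of the two lengths, so that product is at most (H / r)^2 and one length is at
    most H / r. The extra 2 K in the witness pays for moving from the points to the two box
    centres.\<close>
  define H where "H = sqrt (real CARD('l) * (4 * K) / \<mu>)"
  have H: "H \<ge> 0" using K \<mu>(1) by (simp add: H_def)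
  show ?thesis
  proof (rule that[of "H + 2 * K"])
    fix r \<eta>1 \<eta>2 \<eta>3 \<eta>4 p1 p2 p3 p4
    assume r: "r \<ge> (1::real)"
      and \<eta>: "\<eta>1 \<in> ball 0 1" "\<eta>2 \<in> ball 0 1" "\<eta>3 \<in> ball 0 1" "\<eta>4 \<in> ball 0 1"
      and p: "p1 \<in> canonical_box D ?Q r \<eta>1" "p2 \<in> canonical_box D ?Q r \<eta>2"
        "p3 \<in> canonical_box D ?Q r \<eta>3" "p4 \<in> canonical_box D ?Q r \<eta>4"
      and sum: "p1 + p2 = p3 + p4"
    note n1 = near[OF r \<eta>(1) p(1)] and n2 = near[OF r \<eta>(2) p(2)]
      and n3 = near[OF r \<eta>(3) p(3)] and n4 = near[OF r \<eta>(4) p(4)]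
    let ?w = "fst p1 - fst p3" and ?v = "fst p1 - fst p4"
    have fs: "fst p1 + fst p2 = fst p3 + fst p4" using sum by (metis fst_add)
    have ss: "snd p1 $ k + snd p2 $ k = snd p3 $ k + snd p4 $ k" for k
      using sum by (metis snd_add vector_add_component)
    have "\<bar>?w \<bullet> (A k *v ?v)\<bar> \<le> 4 * K / r\<^sup>2" for k
    proof -
      have i: "\<bar>snd p1 $ k - ?Q (fst p1) $ k\<bar> \<le> K / r\<^sup>2" "\<bar>snd p2 $ k - ?Q (fst p2) $ k\<bar> \<le> K / r\<^sup>2"
        "\<bar>snd p3 $ k - ?Q (fst p3) $ k\<bar> \<le> K / r\<^sup>2" "\<bar>snd p4 $ k - ?Q (fst p4) $ k\<bar> \<le> K / r\<^sup>2"
        using n1 n2 n3 n4 by blast+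
      have "4 * K / r\<^sup>2 = 4 * (K / r\<^sup>2)" by simp
      then show ?thesis
        unfolding quad_map_parallelogram[OF fs, symmetric] using i ss[of k] by linarith
    qed
    then have "(\<Sum>k\<in>UNIV. \<bar>?w \<bullet> (A k *v ?v)\<bar>) \<le> (\<Sum>k\<in>(UNIV::'l set). 4 * K / r\<^sup>2)"
      by (intro sum_mono)
    with \<mu>(2)[of ?w ?v] have h: "\<mu> * (norm ?w * norm ?v) \<le> real CARD('l) * (4 * K / r\<^sup>2)" by simp
    have "norm ?w * norm ?v \<le> real CARD('l) * (4 * K / r\<^sup>2) / \<mu>"
      by (subst pos_le_divide_eq[OF \<mu>(1)], subst mult.commute, rule h)
    also have "\<dots> = H\<^sup>2 / r\<^sup>2"
      using \<mu>(1) K by (simp add: H_def)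
    finally have wv: "norm ?w * norm ?v \<le> (H / r) * (H / r)"
      by (simp add: power2_eq_square)
    have "norm ?w \<le> H / r \<or> norm ?v \<le> H / r"
    proof (rule ccontr)
      assume "\<not> (norm ?w \<le> H / r \<or> norm ?v \<le> H / r)"
      then have "(H / r) * (H / r) < norm ?w * norm ?v"
        using H r by (intro mult_strict_mono') auto
      with wv show False by simp
    qed
    moreover have shift: "norm (\<eta> - \<eta>') \<le> (H + 2 * K) / r"
      if "norm (x - y) \<le> H / r" "norm (x - \<eta>) \<le> K / r" "norm (y - \<eta>') \<le> K / r" for x y \<eta> \<eta>' :: "real^'d"
    proof -
      have "norm (\<eta> - \<eta>') \<le> norm (x - y) + norm (x - \<eta>) + norm (y - \<eta>')" by norm
      with that show ?thesis by (simp add: add_divide_distrib)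
    qed
    \<comment> \<open>Opposite sides of the parallelogram are equal, so one small difference
      automatically brings the matching second pair.\<close>
    moreover have "norm (fst p2 - fst p4) = norm ?w" "norm (fst p2 - fst p3) = norm ?v"
    proof -
      have p2: "fst p2 = fst p3 + fst p4 - fst p1" using fs by (simp add: eq_diff_eq add.commute)
      show "norm (fst p2 - fst p4) = norm ?w" "norm (fst p2 - fst p3) = norm ?v"
        unfolding p2 by (simp_all add: norm_minus_commute)
    qed
    ultimately show "norm (\<eta>1 - \<eta>3) \<le> (H + 2 * K) / r \<and> norm (\<eta>2 - \<eta>4) \<le> (H + 2 * K) / r \<or>
        norm (\<eta>1 - \<eta>4) \<le> (H + 2 * K) / r \<and> norm (\<eta>2 - \<eta>3) \<le> (H + 2 * K) / r"
      using n1 n2 n3 n4 by metis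
  qed
qed

end

text \<open>After multiplication by r the differences are integer vectors with entries bounded by K,
  so the count is controlled by a box of integers that does not depend on r.\<close>

lemma scaled_lattice_neighbours:
  fixes K :: real
  shows "\<exists>N::nat. \<forall>r>0. \<forall>\<eta>\<in>scaled_lattice r.
    finite {\<eta>'\<in>scaled_lattice r. norm (\<eta> - \<eta>') \<le> K / r} \<and>
    card {\<eta>'\<in>(scaled_lattice r :: (real^'d) set). norm (\<eta> - \<eta>') \<le> K / r} \<le> N"
proof -
  let ?B = "Pi\<^sub>E (UNIV::'d set) (\<lambda>_. {-\<lceil>K\<rceil>..\<lceil>K\<rceil>})"
  have fin: "finite ?B" by (intro finite_PiE) auto
  show ?thesis
  proof (intro exI[of _ "card ?B"] allI impI ballI)
    fix r :: real and \<eta> :: "real^'d" assume r: "r > 0" and "\<eta> \<in> scaled_lattice r"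
    then obtain z where z: "\<eta> = (1 / r) *\<^sub>R z" "\<And>i. z $ i \<in> \<int>" unfolding scaled_lattice_def by auto
    let ?S = "{\<eta>'\<in>scaled_lattice r. norm (\<eta> - \<eta>') \<le> K / r}"
    let ?h = "\<lambda>g::'d \<Rightarrow> int. (1 / r) *\<^sub>R (z - (\<chi> i. real_of_int (g i)))"
    have "?S \<subseteq> ?h ` ?B"
    proof
      fix \<eta>' assume "\<eta>' \<in> ?S"
      then obtain z' where z': "\<eta>' = (1 / r) *\<^sub>R z'" "\<And>i. z' $ i \<in> \<int>" and n: "norm (\<eta> - \<eta>') \<le> K / r"
        unfolding scaled_lattice_def by auto
      define g where "g = (\<lambda>i. \<lfloor>z $ i - z' $ i\<rfloor>)"
      have g: "real_of_int (g i) = z $ i - z' $ i" for i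
        using Ints_diff[OF z(2) z'(2), of i i] by (auto simp: g_def elim: Ints_cases)
      have "\<bar>real_of_int (g i)\<bar> \<le> K" for i
      proof -
        have "\<bar>(\<eta> - \<eta>') $ i\<bar> \<le> K / r" using component_le_norm_cart[of "\<eta> - \<eta>'" i] n by linarith
        then have "\<bar>1 / r * (z $ i - z' $ i)\<bar> \<le> K / r" by (simp add: z z' right_diff_distrib)
        then show ?thesis using r by (simp add: g abs_mult field_simps)
      qed
      then have "g i \<in> {-\<lceil>K\<rceil>..\<lceil>K\<rceil>}" for i
        by (smt (verit, best) atLeastAtMost_iff ceiling_mono le_of_int_ceiling of_int_ceiling_cancel of_int_le_iff of_int_minus)
      then have "g \<in> ?B" by auto
      moreover have "\<eta>' = ?h g" by (simp add: z' g vec_eq_iff)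
      ultimately show "\<eta>' \<in> ?h ` ?B" by blast
    qed
    then show "finite ?S \<and> card ?S \<le> card ?B"
      using fin by (meson card_image_le card_mono finite_imageI finite_subset order_trans)
  qed
qed

subsection \<open>The reverse square function estimate\<close>

lemma fourier_waves: "fourier f = waves uminus f"
  by (simp add: fourier_def waves_def fun_eq_iff inner_commute)

lemma Lp_norm_4: "Lp_norm 4 f = (LINT x|lborel. norm (f x) ^ 4) powr (1 / 4)"
proof -
  have "norm (f x) powr 4 = norm (f x) ^ 4" for x
    by (cases "f x = 0") (simp_all add: powr_numeral)
  then show ?thesis by (simp add: Lp_norm_def)
qed

lemma integrable_bounded_compact_support:
  fixes h :: "'a::euclidean_space \<Rightarrow> complex"
  assumes [measurable]: "h \<in> borel_measurable borel" and bound: "\<And>x. norm (h x) \<le> B"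
    and K: "compact K" and supp: "\<And>x. h x \<noteq> 0 \<Longrightarrow> x \<in> K"
  shows "integrable lborel h"
proof (rule Bochner_Integration.integrable_bound)
  have "K \<in> sets lborel" using compact_imp_closed[OF K] by simp
  moreover have "emeasure lborel K < \<infinity>" by (rule emeasure_compact_finite[OF K])
  ultimately show "integrable lborel (\<lambda>x. B * indicator K x)" by simp
  show "AE x in lborel. norm (h x) \<le> norm (B * indicator K x)"
  proof (rule AE_I2)
    fix x
    show "norm (h x) \<le> norm (B * indicator K x)"
      using supp[of x] bound[of x] by (cases "h x = 0") auto
  qed
qed simp

lemma inv_fourier_sum:
  assumes "\<And>i. i \<in> I \<Longrightarrow> integrable lborel (h i)"
  shows "inv_fourier (\<lambda>\<xi>. \<Sum>i\<in>I. h i \<xi>) x = (\<Sum>i\<in>I. inv_fourier (h i) x)"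
proof -
  have "integrable lborel (\<lambda>\<xi>. cis (2 * pi * (x \<bullet> \<xi>)) * h i \<xi>)" if "i \<in> I" for i
    by (rule waves_integrable[OF _ assms[OF that]]) simp
  then show ?thesis
    unfolding inv_fourier_def by (simp add: sum_distrib_left)
qed

text \<open>The partition enters through the inclusions of the supports in the boxes, the bounds 0
  and 1, and the continuity and compact support that make the pieces integrable. No derivative of
  \<open>\<psi>\<close> is estimated, so the constant depends on N alone.\<close>

lemma Lp4_norm_le_square_function:
  fixes \<Theta> :: "'a::euclidean_space set set"
  assumes fin: "finite \<Theta>" and part: "smooth_partition \<psi> \<Theta> M"
    and f: "schwartz f" and supp_f: "supp (fourier f) \<subseteq> M"
    and sym: "\<And>\<theta> \<theta>'. R \<theta> \<theta>' \<Longrightarrow> R \<theta>' \<theta>"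
    and card: "\<And>\<theta>. \<theta> \<in> \<Theta> \<Longrightarrow> card {\<theta>' \<in> \<Theta>. R \<theta> \<theta>'} \<le> N"
    and quad: "\<And>\<theta>1 \<theta>2 \<theta>3 \<theta>4 p1 p2 p3 p4. \<theta>1 \<in> \<Theta> \<Longrightarrow> \<theta>2 \<in> \<Theta> \<Longrightarrow> \<theta>3 \<in> \<Theta> \<Longrightarrow> \<theta>4 \<in> \<Theta> \<Longrightarrow>
      p1 \<in> \<theta>1 \<Longrightarrow> p2 \<in> \<theta>2 \<Longrightarrow> p3 \<in> \<theta>3 \<Longrightarrow> p4 \<in> \<theta>4 \<Longrightarrow> p1 + p2 = p3 + p4 \<Longrightarrow>
      R \<theta>1 \<theta>3 \<and> R \<theta>2 \<theta>4 \<or> R \<theta>1 \<theta>4 \<and> R \<theta>2 \<theta>3"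
  shows "Lp_norm 4 f \<le> (2 * (real N)\<^sup>2) powr (1 / 4) * Lp_norm 4 (square_function \<psi> \<Theta> f)"
proof -
  define h where "h \<theta> \<xi> = complex_of_real (\<psi> \<theta> \<xi>) * fourier f \<xi>" for \<theta> \<xi>
  define B where "B = (LINT x|lborel. norm (f x))"
  have fi: "integrable lborel f" by (rule schwartz_integrable[OF f])
  have fc: "continuous_on UNIV f" using f smooth_continuous by (auto simp: schwartz_def)
  obtain B0 where B0: "\<And>x. norm (f x) \<le> B0" using schwartz_bounded[OF f, of 0] by auto
  have [measurable]: "fourier f \<in> borel_measurable borel"
    unfolding fourier_waves by (rule waves_measurable[OF _ fi]) simp
  have \<psi>: "smooth (\<psi> \<theta>)" "compact (supp (\<psi> \<theta>))" "supp (\<psi> \<theta>) \<subseteq> \<theta>" "0 \<le> \<psi> \<theta> x" "\<psi> \<theta> x \<le> 1"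
    if "\<theta> \<in> \<Theta>" for \<theta> x
    using part that by (auto simp: smooth_partition_def)
  have hB: "norm (h \<theta> \<xi>) \<le> B" if "\<theta> \<in> \<Theta>" for \<theta> \<xi>
  proof -
    have "norm (h \<theta> \<xi>) \<le> 1 * norm (fourier f \<xi>)"
      unfolding h_def norm_mult norm_of_real using \<psi>(4,5)[OF that, of \<xi>] by (intro mult_right_mono) auto
    also have "\<dots> \<le> B" unfolding fourier_waves B_def using norm_waves_le[of uminus f \<xi>] by simp
    finally show ?thesis .
  qed
  have hs: "\<xi> \<in> supp (\<psi> \<theta>)" if "h \<theta> \<xi> \<noteq> 0" for \<theta> \<xi>
    using that closure_subset[of "{\<xi>. \<psi> \<theta> \<xi> \<noteq> 0}"] by (auto simp: h_def supp_def)
  have hm: "h \<theta> \<in> borel_measurable borel" if "\<theta> \<in> \<Theta>" for \<theta>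
  proof -
    have [measurable]: "\<psi> \<theta> \<in> borel_measurable borel"
      by (rule borel_measurable_continuous_onI[OF smooth_continuous[OF \<psi>(1)[OF that]]])
    show ?thesis unfolding h_def by measurable
  qed
  have hi: "integrable lborel (h \<theta>)" if "\<theta> \<in> \<Theta>" for \<theta>
    by (rule integrable_bounded_compact_support[OF hm[OF that] hB[OF that] \<psi>(2)[OF that] hs])
  \<comment> \<open>Where \<open>fourier f\<close> vanishes both sides are 0; everywhere else the
    point lies in \<open>M\<close>, where the partition sums to 1.\<close>
  have ft: "fourier f = (\<lambda>\<xi>. \<Sum>\<theta>\<in>\<Theta>. h \<theta> \<xi>)"
  proof
    fix \<xi>
    show "fourier f \<xi> = (\<Sum>\<theta>\<in>\<Theta>. h \<theta> \<xi>)"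
    proof (cases "fourier f \<xi> = 0")
      case False
      then have "\<xi> \<in> M" using supp_f closure_subset[of "{\<xi>. fourier f \<xi> \<noteq> 0}"] by (auto simp: supp_def)
      then have "(\<Sum>\<theta>\<in>\<Theta>. \<psi> \<theta> \<xi>) = 1" using part by (simp add: smooth_partition_def)
      then show ?thesis unfolding h_def
        by (simp add: sum_distrib_right[symmetric] of_real_sum[symmetric] del: of_real_sum)
    qed (simp add: h_def)
  qed
  \<comment> \<open>The hypothesis of Fourier inversion comes from the finite decomposition into
    bounded, compactly supported pieces rather than from decay of the transform.\<close>
  have "integrable lborel (fourier f)"
    unfolding ft by (rule Bochner_Integration.integrable_sum[OF hi])
  then have "f x = inv_fourier (fourier f) x" for x
    using fourier_inversion[OF fi fc B0] by simp
  then have fs: "f x = (\<Sum>\<theta>\<in>\<Theta>. inv_fourier (h \<theta>) x)" for x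
    unfolding ft using inv_fourier_sum[OF hi] by simp
  have sq: "norm (square_function \<psi> \<Theta> f x) ^ 4 = (\<Sum>\<theta>\<in>\<Theta>. (norm (inv_fourier (h \<theta>) x))\<^sup>2)\<^sup>2" for x
  proof -
    let ?s = "\<Sum>\<theta>\<in>\<Theta>. (norm (inv_fourier (h \<theta>) x))\<^sup>2"
    have "norm (square_function \<psi> \<Theta> f x) ^ 4 = ((norm (sqrt ?s))\<^sup>2)\<^sup>2"
      by (simp add: square_function_def fourier_proj_def h_def[abs_def] flip: power_mult)
    also have "(norm (sqrt ?s))\<^sup>2 = ?s" by (simp add: sum_nonneg)
    finally show ?thesis .
  qed
  \<comment> \<open>The compact sets given to the fourth-moment bound are the supports of the
    partition functions, which inherit the relation from the boxes containing them.\<close>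
  have quad': "R \<theta>1 \<theta>3 \<and> R \<theta>2 \<theta>4 \<or> R \<theta>1 \<theta>4 \<and> R \<theta>2 \<theta>3"
    if "\<theta>1 \<in> \<Theta>" "\<theta>2 \<in> \<Theta>" "\<theta>3 \<in> \<Theta>" "\<theta>4 \<in> \<Theta>"
      "p1 \<in> supp (\<psi> \<theta>1)" "p2 \<in> supp (\<psi> \<theta>2)" "p3 \<in> supp (\<psi> \<theta>3)" "p4 \<in> supp (\<psi> \<theta>4)" "p1 + p2 = p3 + p4"
    for \<theta>1 \<theta>2 \<theta>3 \<theta>4 p1 p2 p3 p4
    using quad[of \<theta>1 \<theta>2 \<theta>3 \<theta>4 p1 p2 p3 p4] \<psi>(3) that by blast
  have "(LINT x|lborel. norm (f x) ^ 4) \<le>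
      2 * (real N)\<^sup>2 * (LINT x|lborel. norm (square_function \<psi> \<Theta> f x) ^ 4)"
    unfolding fs sq
    by (rule fourth_moment_le_square_function[OF fin hi hB \<psi>(2) hs sym card quad'])
  then have "(LINT x|lborel. norm (f x) ^ 4) powr (1 / 4) \<le>
      (2 * (real N)\<^sup>2 * (LINT x|lborel. norm (square_function \<psi> \<Theta> f x) ^ 4)) powr (1 / 4)"
    by (intro powr_mono2) auto
  then show ?thesis
    unfolding Lp_norm_4 by (simp add: powr_mult)
qed

theorem theorem1p2:
  fixes A :: "'l::finite \<Rightarrow> real^'d^'d"
    and b :: "'l \<Rightarrow> real^'d"
    and c :: "'l \<Rightarrow> real"
    and Q :: "real^'d \<Rightarrow> real^'l"
    and D :: real
  assumes Q: "Q = quad_map A b c"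
    and symmetric: "\<And>k. transpose (A k) = A k"
    and nondegenerate: "\<exists>\<kappa>>0. \<forall>\<nu>::real^'d. norm \<nu> = 1 \<longrightarrow>
      (\<exists>i::'d \<Rightarrow> 'l. \<bar>det (\<chi> p m. (A (i m) *v \<nu>) $ p)\<bar> \<ge> \<kappa>)"
    and D: "D \<ge> 1"
    and cover: "\<And>\<delta>. 0 < \<delta> \<Longrightarrow> \<delta> < 1 \<Longrightarrow>
      nbhd \<delta> (graph_surface Q) \<subseteq> \<Union> (canonical_cover D Q \<delta>)"
  shows "\<exists>C::real. \<forall>\<delta>. 0 < \<delta> \<and> \<delta> < 1 \<longrightarrow>
    (\<forall>\<psi>. smooth_partition \<psi> (canonical_cover D Q \<delta>) (nbhd \<delta> (graph_surface Q)) \<longrightarrow>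
      (\<forall>f. schwartz f \<and> supp (fourier f) \<subseteq> nbhd \<delta> (graph_surface Q) \<longrightarrow>
        Lp_norm 4 f \<le> C * Lp_norm 4 (square_function \<psi> (canonical_cover D Q \<delta>) f)))"
proof -
  have nondeg: "\<exists>i::'d \<Rightarrow> 'l. det (\<chi> p m. (A (i m) *v \<nu>) $ p) \<noteq> 0" if "norm \<nu> = 1" for \<nu> :: "real^'d"
  proof -
    obtain \<kappa> i where "\<kappa> > 0" "\<kappa> \<le> \<bar>det (\<chi> p m. (A ((i::'d \<Rightarrow> 'l) m) *v \<nu>) $ p)\<bar>"
      using nondegenerate \<open>norm \<nu> = 1\<close> by blast
    then have "det (\<chi> p m. (A (i m) *v \<nu>) $ p) \<noteq> 0" by auto
    then show ?thesis by blast
  qed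
  have "D \<ge> 0" using D by simp
  obtain K where K:
    "\<And>r \<eta>1 \<eta>2 \<eta>3 \<eta>4 p1 p2 p3 p4. r \<ge> 1 \<Longrightarrow>
      \<eta>1 \<in> ball 0 1 \<Longrightarrow> \<eta>2 \<in> ball 0 1 \<Longrightarrow> \<eta>3 \<in> ball 0 1 \<Longrightarrow> \<eta>4 \<in> ball 0 1 \<Longrightarrow>
      p1 \<in> canonical_box D Q r \<eta>1 \<Longrightarrow> p2 \<in> canonical_box D Q r \<eta>2 \<Longrightarrow>
      p3 \<in> canonical_box D Q r \<eta>3 \<Longrightarrow> p4 \<in> canonical_box D Q r \<eta>4 \<Longrightarrow>
      p1 + p2 = p3 + p4 \<Longrightarrow>
      norm (\<eta>1 - \<eta>3) \<le> K / r \<and> norm (\<eta>2 - \<eta>4) \<le> K / r \<or> norm (\<eta>1 - \<eta>4) \<le> K / r \<and> norm (\<eta>2 - \<eta>3) \<le> K / r"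
    unfolding Q using additive_quadruples[of A D, OF symmetric \<open>D \<ge> 0\<close> nondeg] by blast
  obtain N where N: "\<And>r \<eta>. r > 0 \<Longrightarrow> \<eta> \<in> scaled_lattice r \<Longrightarrow>
      finite {\<eta>' \<in> scaled_lattice r. norm (\<eta> - \<eta>') \<le> K / r} \<and>
      card {\<eta>' \<in> (scaled_lattice r :: (real^'d) set). norm (\<eta> - \<eta>') \<le> K / r} \<le> N"
    using scaled_lattice_neighbours[of K] by blast
  show ?thesis
  proof (intro exI[of _ "(2 * (real N)\<^sup>2) powr (1 / 4)"] allI impI)
    fix \<delta> :: real and \<psi> and f :: "(real^'d) \<times> (real^'l) \<Rightarrow> complex"
    let ?\<Theta> = "canonical_cover D Q \<delta>" and ?M = "nbhd \<delta> (graph_surface Q)"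
    assume "0 < \<delta> \<and> \<delta> < 1" and part: "smooth_partition \<psi> ?\<Theta> ?M"
      and f: "schwartz f \<and> supp (fourier f) \<subseteq> ?M"
    then have \<delta>: "0 < \<delta>" "\<delta> < 1" by auto
    define r where "r = 1 / sqrt \<delta>"
    \<comment> \<open>Here \<delta> < 1 enters: r \<ge> 1 is what the box estimates need.\<close>
    have r: "r \<ge> 1" using \<delta> by (simp add: r_def)
    let ?P = "ball 0 1 \<inter> scaled_lattice r :: (real^'d) set"
    have \<Theta>: "?\<Theta> = canonical_box D Q r ` ?P" by (simp add: canonical_cover_def r_def)
    \<comment> \<open>The covering is a set of boxes, not a family indexed by lattice points.
      Choosing one centre per box makes \<eta> injective on the covering, so neighbouring boxes can
      be counted by neighbouring lattice points.\<close>
    define \<eta> where "\<eta> = inv_into ?P (canonical_box D Q r)"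
    have \<eta>P: "\<eta> \<theta> \<in> ball 0 1" "\<eta> \<theta> \<in> scaled_lattice r" and box: "canonical_box D Q r (\<eta> \<theta>) = \<theta>" if "\<theta> \<in> ?\<Theta>" for \<theta>
      using inv_into_into[of \<theta> "canonical_box D Q r" ?P] f_inv_into_f[of \<theta> "canonical_box D Q r" ?P] that
      unfolding \<Theta> \<eta>_def by auto
    show "Lp_norm 4 f \<le> (2 * (real N)\<^sup>2) powr (1 / 4) * Lp_norm 4 (square_function \<psi> ?\<Theta> f)"
    proof (rule Lp4_norm_le_square_function[where M="?M" and R="\<lambda>\<theta> \<theta>'. norm (\<eta> \<theta> - \<eta> \<theta>') \<le> K / r"])
      show "finite ?\<Theta>" by (rule finite_canonical_cover[OF \<delta>(1)])
      show "smooth_partition \<psi> ?\<Theta> ?M" by (rule part)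
      show "schwartz f" "supp (fourier f) \<subseteq> ?M" using f by auto
      show "norm (\<eta> \<theta>' - \<eta> \<theta>) \<le> K / r" if "norm (\<eta> \<theta> - \<eta> \<theta>') \<le> K / r" for \<theta> \<theta>'
        using that by (simp add: norm_minus_commute)
      fix \<theta> assume \<theta>: "\<theta> \<in> ?\<Theta>"
      let ?S = "{\<eta>' \<in> scaled_lattice r. norm (\<eta> \<theta> - \<eta>') \<le> K / r}"
      have fS: "finite ?S \<and> card ?S \<le> N" using N[of r "\<eta> \<theta>"] r \<eta>P(2)[OF \<theta>] by simp
      have "card {\<theta>' \<in> ?\<Theta>. norm (\<eta> \<theta> - \<eta> \<theta>') \<le> K / r} \<le> card ?S"
      proof (rule card_inj_on_le[where f=\<eta>])
        show "inj_on \<eta> {\<theta>' \<in> ?\<Theta>. norm (\<eta> \<theta> - \<eta> \<theta>') \<le> K / r}"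
          by (rule inj_on_inverseI[where g="canonical_box D Q r"]) (use box in auto)
      qed (use fS \<eta>P in auto)
      with fS show "card {\<theta>' \<in> ?\<Theta>. norm (\<eta> \<theta> - \<eta> \<theta>') \<le> K / r} \<le> N" by simp
    next
      fix \<theta>1 \<theta>2 \<theta>3 \<theta>4 p1 p2 p3 p4
      assume t: "\<theta>1 \<in> ?\<Theta>" "\<theta>2 \<in> ?\<Theta>" "\<theta>3 \<in> ?\<Theta>" "\<theta>4 \<in> ?\<Theta>"
        and p: "p1 \<in> \<theta>1" "p2 \<in> \<theta>2" "p3 \<in> \<theta>3" "p4 \<in> \<theta>4" "p1 + p2 = p3 + p4"
      show "norm (\<eta> \<theta>1 - \<eta> \<theta>3) \<le> K / r \<and> norm (\<eta> \<theta>2 - \<eta> \<theta>4) \<le> K / r \<or>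
          norm (\<eta> \<theta>1 - \<eta> \<theta>4) \<le> K / r \<and> norm (\<eta> \<theta>2 - \<eta> \<theta>3) \<le> K / r"
        by (rule K[OF r \<eta>P(1)[OF t(1)] \<eta>P(1)[OF t(2)] \<eta>P(1)[OF t(3)] \<eta>P(1)[OF t(4)], of p1 p2 p3 p4])
          (use p t box in auto)
    qed
  qed
qed

end
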